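(* Let $\omega=\omega(n)$ be any function with $\omega\to\infty$ as $n\to\infty$. Then with high probability (i) $\mathcal{H}_p(n)$ is not homologically connected if $p=\frac{\log n+\frac12\log\log n-\omega}{n}$; (ii) $\mathcal{H}_p(n)$ is homologically connected if $p=\frac{\log n+\frac12\log\log n+\omega}{n}$.
   Context: For $p\in[0,1]$, let $H^3(n,p)$ be the random $3$-uniform hypergraph on vertex set $[n]=\{1,\dots,n\}$ in which each triple of vertices is an edge independently with probability $p$. The random $2$-complex $\mathcal{H}_p(n)$ consists of all vertices of $[n]$ (even those in no triple), all triples of $H^3(n,p)$ (called faces), and all pairs contained in some such triple (called edges); i.e. it is the downward closure of the edge set of $H^3(n,p)$ together with all singletons. The shadow graph is the graph on $[n]$ whose edges are the edges of the complex. A simplicial complex $X$ is homologically connected if $H_0(X;\mathbb{F}_2)$ and $H_1(X;\mathbb{F}_2)$ both vanish; equivalently, the shadow graph is connected and every $0$-$1$ function on the edges of $X$ which takes the value $1$ on an even number of the three edges of each face is induced by a $0$-$1$ function $g$ on the vertices (i.e. equals $1$ exactly on those edges $uv$ with $g(u)\neq g(v)$). "With high probability" means with probability tending to $1$ as $n\to\infty$. *)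

theory Defs
  imports "HOL-Probability.Probability" "HOL-Algebra.Elementary_Groups" "HOL-Library.Z2"
begin

definition triples :: "nat \<Rightarrow> nat set set" where
  "triples n = {t. t \<subseteq> {1..n} \<and> card t = 3}"

definition random_hypergraph :: "nat \<Rightarrow> real \<Rightarrow> nat set set pmf" where
  "random_hypergraph n p =
     map_pmf (\<lambda>f. {t \<in> triples n. f t}) (Pi_pmf (triples n) False (\<lambda>_. bernoulli_pmf p))"

text \<open>An abstract simplicial complex is given by the set of its nonempty simplices.\<close>

definition hypergraph_complex :: "nat \<Rightarrow> nat set set \<Rightarrow> nat set set" where
  "hypergraph_complex n E = {s. s \<noteq> {} \<and> (\<exists>t\<in>E. s \<subseteq> t)} \<union> {{v} | v. v \<in> {1..n}}"

definition simplices :: "'a set set \<Rightarrow> nat \<Rightarrow> 'a set set" where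
  "simplices X k = {s \<in> X. card s = Suc k}"

text \<open>Chains have coefficients in \<open>\<F>\<^sub>2\<close>, the type \<^typ>\<open>bit\<close>, so no orientations are needed.\<close>

definition simplicial_chains :: "'a set set \<Rightarrow> nat \<Rightarrow> ('a set \<Rightarrow> bit) set" where
  "simplicial_chains X k = {c. finite {s. c s \<noteq> 0} \<and> (\<forall>s. c s \<noteq> 0 \<longrightarrow> s \<in> simplices X k)}"

definition chain_group :: "'a set set \<Rightarrow> nat \<Rightarrow> ('a set \<Rightarrow> bit) monoid" where
  "chain_group X k = \<lparr>carrier = simplicial_chains X k, mult = (\<lambda>c d s. c s + d s), one = (\<lambda>s. 0)\<rparr>"

text \<open>
  The boundary of a chain of dimension \<open>k\<close>; its faces of dimension \<open>k - 1\<close> have \<open>k\<close> elements.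
  For \<open>k = 0\<close> the only face is the empty set, and the map is the augmentation, sending a chain
  to the sum of its coefficients. The homology below is therefore reduced, which makes a
  difference in dimension \<open>0\<close> only.
\<close>

definition boundary :: "nat \<Rightarrow> ('a set \<Rightarrow> bit) \<Rightarrow> 'a set \<Rightarrow> bit" where
  "boundary k c = (\<lambda>s. if card s = k then \<Sum>t | s \<subseteq> t \<and> c t \<noteq> 0. c t else 0)"

definition cycles :: "'a set set \<Rightarrow> nat \<Rightarrow> ('a set \<Rightarrow> bit) set" where
  "cycles X k = {c \<in> simplicial_chains X k. boundary k c = (\<lambda>s. 0)}"

definition boundaries :: "'a set set \<Rightarrow> nat \<Rightarrow> ('a set \<Rightarrow> bit) set" where
  "boundaries X k = boundary (Suc k) ` simplicial_chains X (Suc k)"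

definition reduced_homology_group :: "'a set set \<Rightarrow> nat \<Rightarrow> ('a set \<Rightarrow> bit) set monoid" where
  "reduced_homology_group X k = (chain_group X k)\<lparr>carrier := cycles X k\<rparr> Mod boundaries X k"

definition homologically_connected :: "'a set set \<Rightarrow> bool" where
  "homologically_connected X \<longleftrightarrow>
     trivial_group (reduced_homology_group X 0) \<and> trivial_group (reduced_homology_group X 1)"

end

theory Submission
  imports Defs "HOL-Real_Asymp.Real_Asymp"
begin

text \<open>
  Homological connectedness is dual to the statement that every \<open>\<F>\<^sub>2\<close>-valued cocycle on the edges
  is a coboundary. The critical cocycles consist of two edges \<open>uv\<close>, \<open>uw\<close> that lie in no face
  other than \<open>uvw\<close>: there are about \<open>n\<^sup>3 p exp (- 2 n p)\<close> of them, which is of constant order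
  for \<open>n p = log n + log log n / 2\<close>.

  Below the threshold their number is concentrated by the second moment method. If it exceeds \<open>n\<close>,
  they cannot all be coboundaries, as there are only \<open>2 ^ n\<close> of these; for larger \<open>p\<close>, where there may
  be few, one of them is not a coboundary because \<open>u\<close> and \<open>v\<close> have a further common neighbour in the
  shadow graph. For very small \<open>p\<close> there are isolated vertices.

  Above the threshold, consider a smallest cocycle \<open>G\<close> that is not a coboundary, with \<open>m\<close> edges.
  By minimality its edges are linked together by \<open>m - 1\<close> faces containing two of them each, and at
  least \<open>n m / 3\<close> triples contain an odd number of edges of \<open>G\<close> (at least \<open>m (n - 2 m)\<close> for small \<open>m\<close>);
  none of these is a face. Traversals of trees bound the number of such linked sets by
  \<open>n\<^sup>2 (16 n) ^ (m - 1)\<close>, and a union bound finishes the proof.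
\<close>

section \<open>Cocycles and homology modulo 2\<close>

text \<open>Homological connectedness is not monotone in the faces: a new triple brings new edges,
  which may carry new cocycles. As \<open>\<omega>\<close> may grow slowly or fast, \<open>p\<close>
  cannot be replaced by a convenient value, and each half has to cover its whole range of densities.
  The decisive parameter is c = n p. The mean number of critical pairs is of order n^2 c exp (- 2
  c); the summand log log n / 2 in c cancels the factor c and leaves exp (2 \<omega>) or exp (- 2
  \<omega>), up to factors under control. Below the threshold this function of c can fall below n at
  both ends of the range, so that comparing it with n works only in between. Above the threshold,
  each linking face supplies a factor p. A further edge of a cocycle therefore costs 16 c exp (- c /
  3), which tends to 0, whereas a factor n^2 for the free choice of each edge would ruin the union
  bound. Minimality enters twice: for the linking and for the number of odd triples.\<close>

declare add_bit_eq_xor [simp del] mult_bit_eq_and [simp del]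

lemma bit_add_self [simp]: "b + b = (0::bit)"
  by (cases b) simp_all

lemma bit_add_self_left [simp]: "b + (b + c) = (c::bit)"
  by (metis add.assoc add_0 bit_add_self)

lemma bit_add_eq_0_iff: "a + b = 0 \<longleftrightarrow> a = (b::bit)"
  by (cases a; cases b) simp_all

lemma bit_add_eq_1_iff: "a + b = 1 \<longleftrightarrow> a \<noteq> (b::bit)"
  by (cases a; cases b) simp_all

lemma sum_bit_eq_parity:
  assumes "finite A"
  shows "(\<Sum>x\<in>A. f x :: bit) = of_bool (odd (card {x\<in>A. f x = 1}))"
  using assms
proof induction
  case empty
  then show ?case by simp
next
  case (insert x A)
  have "{y \<in> insert x A. f y = 1} =
      (if f x = 1 then insert x {y\<in>A. f y = 1} else {y\<in>A. f y = 1})"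
    by auto
  with insert show ?case
    by (cases "f x") auto
qed

text \<open>The transpose of \<open>boundary k\<close>. As there, \<open>k\<close> counts the
  elements of the faces, so \<open>coboundary 1\<close> takes vertex functions to edge functions and
  \<open>coboundary 2\<close> edge functions to face functions. It refers to no complex.\<close>

definition coboundary :: "nat \<Rightarrow> ('a set \<Rightarrow> bit) \<Rightarrow> 'a set \<Rightarrow> bit" where
  "coboundary k f t = (\<Sum>s | s \<subseteq> t \<and> card s = k. f s)"

definition singleton_chain :: "'a set \<Rightarrow> 'a set \<Rightarrow> bit" where
  "singleton_chain s = (\<lambda>t. of_bool (t = s))"

section \<open>Chains and cochains of a finite complex and their pairing\<close>

locale finite_complex =
  fixes V :: "'a set" and X :: "'a set set"
  assumes finite_V: "finite V"
    and simplex_subset: "s \<in> X \<Longrightarrow> s \<subseteq> V"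
    and face_closed: "\<lbrakk>t \<in> X; s \<subseteq> t; s \<noteq> {}\<rbrakk> \<Longrightarrow> s \<in> X"
    and vertex_mem: "v \<in> V \<Longrightarrow> {v} \<in> X"
begin

definition pairing :: "('a set \<Rightarrow> bit) \<Rightarrow> ('a set \<Rightarrow> bit) \<Rightarrow> bit" where
  "pairing f c = (\<Sum>s\<in>Pow V. f s * c s)"

lemma chain_iff: "c \<in> simplicial_chains X k \<longleftrightarrow> (\<forall>s. c s = 1 \<longrightarrow> s \<in> simplices X k)"
proof -
  have "finite {s. c s = 1}" if "\<forall>s. c s = 1 \<longrightarrow> s \<in> simplices X k"
    by (rule finite_subset[of _ "Pow V"]) (use that simplex_subset finite_V in \<open>auto simp: simplices_def\<close>)
  then show ?thesis
    by (auto simp: simplicial_chains_def)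
qed

lemma chain_support: "c \<in> simplicial_chains X k \<Longrightarrow> c s = 1 \<Longrightarrow> s \<subseteq> V"
  using simplex_subset by (auto simp: chain_iff simplices_def)

lemma chain_add:
  assumes "c \<in> simplicial_chains X k" "d \<in> simplicial_chains X k"
  shows "(\<lambda>s. c s + d s) \<in> simplicial_chains X k"
  using assms unfolding chain_iff
proof (intro allI impI)
  fix s assume "c s + d s = 1"
  then have "c s = 1 \<or> d s = 1" by (cases "c s") auto
  then show "s \<in> simplices X k" using assms by (auto simp: chain_iff)
qed

lemma chain_zero: "(\<lambda>s. 0) \<in> simplicial_chains X k"
  by (simp add: chain_iff)

lemma chain_singleton: "s \<in> simplices X k \<Longrightarrow> singleton_chain s \<in> simplicial_chains X k"
  by (simp add: chain_iff singleton_chain_def)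

lemma boundary_eq:
  assumes "c \<in> simplicial_chains X j"
  shows "boundary k c s = (if card s = k then \<Sum>t\<in>Pow V. of_bool (s \<subseteq> t) * c t else 0)"
proof -
  have "(\<Sum>t | s \<subseteq> t \<and> c t \<noteq> 0. c t) = (\<Sum>t\<in>Pow V. of_bool (s \<subseteq> t) * c t)"
    by (rule sum.mono_neutral_cong_left)
       (use finite_V chain_support[OF assms] in auto)
  then show ?thesis
    by (simp add: boundary_def)
qed

lemma boundary_add:
  assumes "c \<in> simplicial_chains X j" "d \<in> simplicial_chains X j"
  shows "boundary k (\<lambda>s. c s + d s) = (\<lambda>s. boundary k c s + boundary k d s)"
  by (rule ext)
     (simp add: boundary_eq[OF assms(1)] boundary_eq[OF assms(2)] boundary_eq[OF chain_add[OF assms]]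
      distrib_left sum.distrib)

lemma boundary_zero: "boundary k (\<lambda>s. 0) = (\<lambda>s. 0)"
  by (simp add: boundary_def fun_eq_iff)

lemma boundary_singleton:
  "boundary k (singleton_chain t) = (\<lambda>s. of_bool (card s = k \<and> s \<subseteq> t))"
proof
  fix s
  have "{u. s \<subseteq> u \<and> singleton_chain t u \<noteq> 0} = (if s \<subseteq> t then {t} else {})"
    by (auto simp: singleton_chain_def)
  then show "boundary k (singleton_chain t) s = of_bool (card s = k \<and> s \<subseteq> t)"
    by (simp add: boundary_def singleton_chain_def)
qed

lemma boundary_chain:
  assumes "c \<in> simplicial_chains X (Suc k)"
  shows "boundary (Suc k) c \<in> simplicial_chains X k"
  unfolding chain_iff
proof (intro allI impI)
  fix s assume s: "boundary (Suc k) c s = 1"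
  then have cs: "card s = Suc k"
    by (auto simp: boundary_def split: if_splits)
  have "{t. s \<subseteq> t \<and> c t \<noteq> 0} \<noteq> {}"
  proof
    assume "{t. s \<subseteq> t \<and> c t \<noteq> 0} = {}"
    with s show False by (simp only: boundary_def) (simp split: if_splits)
  qed
  then obtain t where "s \<subseteq> t" "t \<in> simplices X (Suc k)"
    using assms by (auto simp: chain_iff)
  with cs show "s \<in> simplices X k"
    using face_closed[of t s] by (cases "s = {}") (auto simp: simplices_def)
qed

text \<open>Adjointness by double counting: either side sums \<open>f s * c t\<close> over all
  \<open>s \<subseteq> t\<close> with \<open>card s = k\<close>.\<close>

lemma pairing_boundary:
  assumes "c \<in> simplicial_chains X j"
  shows "pairing f (boundary k c) = pairing (coboundary k f) c"
proof -
  have "pairing f (boundary k c) =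
      (\<Sum>s\<in>Pow V. \<Sum>t\<in>Pow V. of_bool (card s = k \<and> s \<subseteq> t) * f s * c t)"
    unfolding pairing_def boundary_eq[OF assms]
    by (rule sum.cong) (auto simp: sum_distrib_left intro!: sum.cong)
  also have "\<dots> = (\<Sum>t\<in>Pow V. \<Sum>s\<in>Pow V. of_bool (card s = k \<and> s \<subseteq> t) * f s * c t)"
    by (rule sum.swap)
  also have "\<dots> = pairing (coboundary k f) c"
    unfolding pairing_def
  proof (rule sum.cong)
    fix t assume t: "t \<in> Pow V"
    have "coboundary k f t = (\<Sum>s\<in>Pow V. of_bool (card s = k \<and> s \<subseteq> t) * f s)"
      unfolding coboundary_def
      by (rule sum.mono_neutral_cong_left) (use finite_V t in auto)
    then show "(\<Sum>s\<in>Pow V. of_bool (card s = k \<and> s \<subseteq> t) * f s * c t) = coboundary k f t * c t"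
      by (simp add: sum_distrib_right)
  qed simp
  finally show ?thesis .
qed

lemma pairing_add: "pairing f (\<lambda>s. c s + d s) = pairing f c + pairing f d"
  by (simp add: pairing_def distrib_left sum.distrib)

lemma pairing_singleton: "s \<subseteq> V \<Longrightarrow> pairing f (singleton_chain s) = f s"
  using finite_V by (simp add: pairing_def singleton_chain_def sum.delta' if_distrib of_bool_def cong: if_cong)

lemma pairing_eq_0:
  assumes "c \<in> simplicial_chains X k" "\<And>s. s \<in> simplices X k \<Longrightarrow> f s = 0"
  shows "pairing f c = 0"
proof -
  have "f s * c s = 0" for s
    using assms by (cases "c s") (auto simp: chain_iff)
  then show ?thesis unfolding pairing_def by (intro sum.neutral) simp
qed

text \<open>The coefficient at \<open>s\<close> is the pairing with the indicator of the supersets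
  of \<open>s\<close>. Moving one boundary to the other side leaves a count: between a set
  \<open>s\<close> of size \<open>k\<close> and a simplex \<open>T\<close> of size
  \<open>k + 2\<close> containing it there are exactly two sets of size
  \<open>k + 1\<close>.\<close>

lemma boundary_boundary:
  assumes "c \<in> simplicial_chains X (Suc k)"
  shows "boundary k (boundary (Suc k) c) = (\<lambda>s. 0)"
proof
  fix s
  show "boundary k (boundary (Suc k) c) s = 0"
  proof (cases "card s = k \<and> finite s")
    case True
    have "boundary k (boundary (Suc k) c) s = pairing (\<lambda>t. of_bool (s \<subseteq> t)) (boundary (Suc k) c)"
      using boundary_eq[OF boundary_chain[OF assms]] True by (simp add: pairing_def)
    also have "\<dots> = pairing (coboundary (Suc k) (\<lambda>t. of_bool (s \<subseteq> t))) c"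
      by (rule pairing_boundary[OF assms])
    also have "\<dots> = 0"
    proof (rule pairing_eq_0[OF assms])
      fix T assume T: "T \<in> simplices X (Suc k)"
      then have cT: "card T = Suc (Suc k)"
        by (simp add: simplices_def)
      then have fT: "finite T"
        by (simp add: card_ge_0_finite)
      have eq: "{t \<in> {t. t \<subseteq> T \<and> card t = Suc k}. (of_bool (s \<subseteq> t) :: bit) = 1} =
          (if s \<subseteq> T then (\<lambda>a. insert a s) ` (T - s) else {})"
        (is "?L = _")
      proof -
        have "t \<in> (\<lambda>a. insert a s) ` (T - s)" if t: "t \<subseteq> T" "card t = Suc k" "s \<subseteq> t" for t
        proof -
          have "card (t - s) = 1"
            using t True by (simp add: card_Diff_subset)
          then obtain a where "t - s = {a}"
            by (auto simp: card_1_singleton_iff)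
          with t show ?thesis by auto
        qed
        then show ?thesis
          using True by (auto simp: of_bool_def split: if_splits)
      qed
      have "even (card ?L)"
      proof (cases "s \<subseteq> T")
        case sT: True
        have "card ?L = card (T - s)"
          unfolding eq using sT by (auto intro!: card_image simp: inj_on_def)
        also have "\<dots> = 2"
          using sT True cT by (simp add: card_Diff_subset)
        finally show ?thesis by simp
      next
        case False
        then show ?thesis unfolding eq by simp
      qed
      then show "coboundary (Suc k) (\<lambda>t. of_bool (s \<subseteq> t)) T = 0"
        unfolding coboundary_def using fT by (subst sum_bit_eq_parity) auto
    qed
    finally show ?thesis .
  next
    case False
    then have "\<not> s \<subseteq> t" if "card s = k" "t \<in> Pow V" for t
      using finite_V that by (auto dest: finite_subset)
    then show ?thesis
      unfolding boundary_eq[OF boundary_chain[OF assms]] by (auto intro!: sum.neutral)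
  qed
qed

text \<open>If the quotient is trivial, the coset of a cycle is the subgroup of boundaries itself
  and contains the cycle. Conversely the two sets coincide because the boundary of a boundary
  vanishes, and a group modulo itself has a single coset.\<close>

lemma trivial_homology_iff:
  "trivial_group (reduced_homology_group X k) \<longleftrightarrow> cycles X k \<subseteq> boundaries X k"
proof
  let ?G = "(chain_group X k)\<lparr>carrier := cycles X k\<rparr>"
  show "cycles X k \<subseteq> boundaries X k" if "trivial_group (reduced_homology_group X k)"
  proof
    fix c assume c: "c \<in> cycles X k"
    have "boundaries X k #>\<^bsub>?G\<^esub> c \<in> carrier (reduced_homology_group X k)"
      using c unfolding reduced_homology_group_def FactGroup_def RCOSETS_def by auto
    then have "boundaries X k #>\<^bsub>?G\<^esub> c = boundaries X k"
      using that by (simp add: trivial_group_def reduced_homology_group_def)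
    moreover have "(\<lambda>s. 0) \<in> boundaries X k"
      unfolding boundaries_def by (rule image_eqI[OF _ chain_zero]) (simp add: boundary_zero)
    then have "c \<in> boundaries X k #>\<^bsub>?G\<^esub> c"
      by (force simp: r_coset_def chain_group_def)
    ultimately show "c \<in> boundaries X k" by simp
  qed
  show "trivial_group (reduced_homology_group X k)" if *: "cycles X k \<subseteq> boundaries X k"
  proof -
    have eq: "boundaries X k = cycles X k"
      using * boundary_chain boundary_boundary by (auto simp: boundaries_def cycles_def)
    have cg: "comm_group ?G"
    proof (rule comm_groupI; simp add: chain_group_def)
      fix c d assume cd: "c \<in> cycles X k" "d \<in> cycles X k"
      then show "(\<lambda>s. c s + d s) \<in> cycles X k"
        using boundary_add[of c k d k] by (simp add: cycles_def chain_add)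
      show "(\<lambda>s. c s + d s) = (\<lambda>s. d s + c s)"
        by (simp add: add.commute)
    next
      show "(\<lambda>s. 0) \<in> cycles X k"
        by (simp add: cycles_def chain_zero boundary_zero)
    next
      fix c assume "c \<in> cycles X k"
      then show "\<exists>d\<in>cycles X k. (\<lambda>s. d s + c s) = (\<lambda>s. 0)"
        by (intro bexI[of _ c]) auto
    qed (simp add: add.assoc)
    interpret comm_group ?G by (rule cg)
    have sub: "subgroup (cycles X k) ?G"
      using subgroup_self by simp
    have nor: "normal (cycles X k) ?G"
      by (rule subgroup_imp_normal[OF sub])
    have "group (?G Mod cycles X k)"
      by (rule normal.factorgroup_is_group[OF nor])
    moreover have "carrier (?G Mod cycles X k) = {cycles X k}"
      using coset_join2[OF _ sub] one_closed unfolding FactGroup_def RCOSETS_def by auto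
    ultimately show ?thesis
      by (simp add: trivial_group_def reduced_homology_group_def eq)
  qed
qed

section \<open>Vanishing homology in dimensions 0 and 1 in terms of cochains\<close>

lemma homologically_connected_iff:
  "homologically_connected X \<longleftrightarrow> cycles X 0 \<subseteq> boundaries X 0 \<and> cycles X 1 \<subseteq> boundaries X 1"
  by (simp add: homologically_connected_def trivial_homology_iff)

lemma edge_boundary:
  assumes "u \<noteq> v"
  shows "boundary 1 (singleton_chain {u, v}) = (\<lambda>s. singleton_chain {u} s + singleton_chain {v} s)"
  unfolding boundary_singleton using assms
  by (auto simp: fun_eq_iff singleton_chain_def card_1_singleton_iff)

lemma vertex_simplex: "v \<in> V \<Longrightarrow> {v} \<in> simplices X 0"
  using vertex_mem by (simp add: simplices_def)

lemma vertex_difference_cycle: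
  assumes "u \<in> V" "v \<in> V"
  shows "(\<lambda>s. singleton_chain {u} s + singleton_chain {v} s) \<in> cycles X 0"
proof -
  note c = chain_singleton[OF vertex_simplex[OF assms(1)]] chain_singleton[OF vertex_simplex[OF assms(2)]]
  have "boundary 0 (\<lambda>s. singleton_chain {u} s + singleton_chain {v} s) = (\<lambda>s. 0)"
    unfolding boundary_add[OF c] boundary_singleton
    by (auto simp: fun_eq_iff card_eq_0_iff dest: finite_subset)
  then show ?thesis
    using chain_add[OF c] by (simp add: cycles_def)
qed

lemma coboundary_edge:
  assumes "u \<noteq> v"
  shows "coboundary 1 g {u, v} = g {u} + g {v}"
proof -
  have "{s. s \<subseteq> {u, v} \<and> card s = 1} = {{u}, {v}}"
    by (auto simp: card_1_singleton_iff)
  then show ?thesis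
    using assms by (simp add: coboundary_def)
qed

text \<open>The potential of a vertex is the value of the cocycle on a chain joining it to a root.\<close>

lemma cocycle_imp_coboundary:
  assumes "homologically_connected X"
    and cocycle: "\<And>t. t \<in> simplices X 2 \<Longrightarrow> coboundary 2 f t = 0"
  obtains g where "\<And>e. e \<in> simplices X 1 \<Longrightarrow> f e = coboundary 1 g e"
proof (cases "V = {}")
  case True
  then have "simplices X 1 = {}"
    using simplex_subset by (force simp: simplices_def)
  then show ?thesis using that by blast
next
  case False
  then obtain r where r: "r \<in> V" by blast
  have "\<exists>c\<in>simplicial_chains X 1. boundary 1 c = (\<lambda>s. singleton_chain {v} s + singleton_chain {r} s)"
    if "v \<in> V" for v
    using vertex_difference_cycle[OF that r] assms(1)
    by (auto simp: homologically_connected_iff boundaries_def image_iff set_eq_iff subset_iff) metis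
  then obtain C where C: "\<And>v. v \<in> V \<Longrightarrow> C v \<in> simplicial_chains X 1"
    and bC: "\<And>v. v \<in> V \<Longrightarrow> boundary 1 (C v) = (\<lambda>s. singleton_chain {v} s + singleton_chain {r} s)"
    by metis
  define g where "g = (\<lambda>s. pairing f (C (the_elem s)))"
  have "f e = coboundary 1 g e" if e: "e \<in> simplices X 1" for e
  proof -
    obtain u v where uv: "e = {u, v}" "u \<noteq> v"
      using e by (auto simp: simplices_def card_Suc_eq)
    have V: "u \<in> V" "v \<in> V" "e \<subseteq> V"
      using e simplex_subset[of e] uv by (auto simp: simplices_def)
    note ch = C[OF V(1)] C[OF V(2)] chain_singleton[OF e]
    \<comment> \<open>The chains joining the root to \<open>u\<close> and \<open>v\<close> form a
      cycle together with \<open>e\<close>; it bounds, and a cocycle vanishes on boundaries.\<close>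
    define z where "z = (\<lambda>s. (C u s + C v s) + singleton_chain e s)"
    have z: "z \<in> simplicial_chains X 1"
      unfolding z_def by (intro chain_add ch)
    have "boundary 1 z = (\<lambda>s. boundary 1 (C u) s + boundary 1 (C v) s + boundary 1 (singleton_chain e) s)"
      unfolding z_def boundary_add[OF chain_add[OF ch(1,2)] ch(3)] boundary_add[OF ch(1,2)] ..
    also have "\<dots> = (\<lambda>s. 0)"
      unfolding bC[OF V(1)] bC[OF V(2)] uv(1) edge_boundary[OF uv(2)]
      by (simp add: fun_eq_iff add_ac)
    finally have "boundary 1 z = (\<lambda>s. 0)" .
    with z have "z \<in> cycles X 1" by (simp add: cycles_def)
    then obtain d where d: "d \<in> simplicial_chains X 2" "z = boundary 2 d"
      using assms(1) by (auto simp: homologically_connected_iff boundaries_def numeral_2_eq_2)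
    have "pairing f z = 0"
      unfolding d(2) pairing_boundary[OF d(1)] by (rule pairing_eq_0[OF d(1) cocycle])
    then have "pairing f (C u) + pairing f (C v) + f e = 0"
      unfolding z_def pairing_add pairing_singleton[OF V(3)] .
    then show ?thesis
      unfolding uv(1) coboundary_edge[OF uv(2)] by (simp add: g_def bit_add_eq_0_iff)
  qed
  then show ?thesis using that by blast
qed

text \<open>Linear duality in a finite space over the field with two elements. A maximal additive
  set \<open>W\<close> that contains \<open>B\<close> and avoids \<open>z\<close> is a hyperplane,
  and \<open>f\<close> is read off from the functional with kernel \<open>W\<close>.\<close>

lemma separating_cochain:
  assumes B: "B \<subseteq> simplicial_chains X k" "(\<lambda>s. 0) \<in> B"
    and B_add: "\<And>c d. c \<in> B \<Longrightarrow> d \<in> B \<Longrightarrow> (\<lambda>s. c s + d s) \<in> B"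
    and z: "z \<in> simplicial_chains X k" "z \<notin> B"
  obtains f where "\<And>c. c \<in> B \<Longrightarrow> pairing f c = 0" "pairing f z = 1"
proof -
  let ?C = "simplicial_chains X k"
  define \<W> where "\<W> = {W. B \<subseteq> W \<and> W \<subseteq> ?C \<and> z \<notin> W \<and> (\<forall>c\<in>W. \<forall>d\<in>W. (\<lambda>s. c s + d s) \<in> W)}"
  have finC: "finite ?C"
  proof (rule finite_subset)
    show "?C \<subseteq> (\<lambda>A s. of_bool (s \<in> A)) ` Pow (Pow V)"
    proof
      fix c assume c: "c \<in> ?C"
      have "c = (\<lambda>s. of_bool (s \<in> {s. c s = 1}))"
        by (auto simp: fun_eq_iff)
      moreover have "{s. c s = 1} \<in> Pow (Pow V)"
        using chain_support[OF c] by auto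
      ultimately show "c \<in> (\<lambda>A s. of_bool (s \<in> A)) ` Pow (Pow V)"
        by blast
    qed
  qed (use finite_V in simp)
  have "finite \<W>"
    by (rule finite_subset[of _ "Pow ?C"]) (use finC in \<open>auto simp: \<W>_def\<close>)
  moreover have "B \<in> \<W>"
    using B B_add z by (auto simp: \<W>_def)
  ultimately obtain W where W: "W \<in> \<W>" and max: "\<And>W'. W' \<in> \<W> \<Longrightarrow> W \<subseteq> W' \<Longrightarrow> W' = W"
    using finite_has_maximal2[of \<W> B] by blast
  have BW: "B \<subseteq> W" and WC: "W \<subseteq> ?C" and zW: "z \<notin> W"
    and W_add: "\<And>c d. c \<in> W \<Longrightarrow> d \<in> W \<Longrightarrow> (\<lambda>s. c s + d s) \<in> W"
    using W by (auto simp: \<W>_def)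
  have W0: "(\<lambda>s. 0) \<in> W" using BW B by blast
  \<comment> \<open>Codimension one: otherwise adjoining \<open>c\<close> would enlarge
    \<open>W\<close> without reaching \<open>z\<close>.\<close>
  have half: "(\<lambda>s. c s + z s) \<in> W" if c: "c \<in> ?C" "c \<notin> W" for c
  proof (rule ccontr)
    assume n: "(\<lambda>s. c s + z s) \<notin> W"
    define W' where "W' = W \<union> (\<lambda>w s. c s + w s) ` W"
    have "z \<notin> W'"
    proof
      assume "z \<in> W'"
      then obtain w where "w \<in> W" "z = (\<lambda>s. c s + w s)"
        using zW by (auto simp: W'_def)
      then have "(\<lambda>s. c s + z s) = w" by (auto simp: fun_eq_iff)
      with n \<open>w \<in> W\<close> show False by simp
    qed
    moreover have "W' \<subseteq> ?C"
      using WC c chain_add by (auto simp: W'_def)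
    moreover have "(\<lambda>s. a s + b s) \<in> W'" if "a \<in> W'" "b \<in> W'" for a b
    proof -
      obtain a' where a': "a' \<in> W" "a = a' \<or> a = (\<lambda>s. c s + a' s)" using \<open>a \<in> W'\<close> by (auto simp: W'_def)
      obtain b' where b': "b' \<in> W" "b = b' \<or> b = (\<lambda>s. c s + b' s)" using \<open>b \<in> W'\<close> by (auto simp: W'_def)
      have s: "(\<lambda>s. a' s + b' s) \<in> W" using a' b' W_add by blast
      have "(\<lambda>s. a s + b s) = (\<lambda>s. a' s + b' s) \<or> (\<lambda>s. a s + b s) = (\<lambda>s. c s + (a' s + b' s))"
        using a'(2) b'(2) by (auto simp: fun_eq_iff add_ac)
      with s show ?thesis by (auto simp: W'_def)
    qed
    ultimately have "W' \<in> \<W>"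
      using BW by (auto simp: \<W>_def W'_def)
    then have "W' = W" using max by (auto simp: W'_def)
    moreover have "c \<in> W'" using W0 by (force simp: W'_def)
    ultimately show False using c by simp
  qed
  \<comment> \<open>Prescribed on single simplices only; by additivity the pairing with
    \<open>f\<close> then vanishes exactly on the chains in \<open>W\<close>.\<close>
  define f where "f = (\<lambda>s. of_bool (singleton_chain s \<notin> W) :: bit)"
  have f: "pairing f c = of_bool (c \<notin> W)" if c: "c \<in> ?C" for c
  proof -
    have "finite {s. c s = 1}"
      using c by (simp add: simplicial_chains_def)
    then show ?thesis using c
    proof (induction "{s. c s = 1}" arbitrary: c rule: finite_induct)
      case empty
      then have "c = (\<lambda>s. 0)" by (auto simp: fun_eq_iff)
      then show ?case using W0 by (simp add: pairing_def)
    next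
      case (insert x F)
      define d where "d = (\<lambda>s. c s + singleton_chain x s)"
      have cx: "c x = 1" using insert.hyps by blast
      then have x: "x \<in> simplices X k" using insert.prems by (simp add: chain_iff)
      have d: "d \<in> ?C"
        unfolding d_def by (rule chain_add[OF insert.prems chain_singleton[OF x]])
      have "F = {s. d s = 1}"
        using insert.hyps cx by (auto simp: d_def singleton_chain_def bit_add_eq_1_iff)
      then have IH: "pairing f d = of_bool (d \<notin> W)"
        using insert.hyps(3) d by blast
      have c_eq: "c = (\<lambda>s. d s + singleton_chain x s)"
        by (simp add: d_def fun_eq_iff add.assoc)
      have xV: "x \<subseteq> V" using chain_support[OF insert.prems cx] .
      have "pairing f c = of_bool (d \<notin> W) + of_bool (singleton_chain x \<notin> W)"
        unfolding c_eq pairing_add IH pairing_singleton[OF xV] by (simp add: f_def)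
      moreover have "c \<in> W \<longleftrightarrow> (d \<in> W \<longleftrightarrow> singleton_chain x \<in> W)"
      proof -
        have 1: "c \<in> W" if "d \<in> W" "singleton_chain x \<in> W" using W_add[OF that] c_eq by simp
        have 2: "d \<in> W" if "c \<in> W" "singleton_chain x \<in> W" using W_add[OF that] d_def by simp
        have 3: "singleton_chain x \<in> W" if "d \<in> W" "c \<in> W"
          using W_add[OF that] by (simp add: d_def add_ac)
        have 4: "c \<in> W" if "d \<notin> W" "singleton_chain x \<notin> W"
          using W_add[OF half[OF d that(1)] half[OF chain_singleton[OF x] that(2)]]
          by (simp add: c_eq add_ac)
        show ?thesis using 1 2 3 4 by blast
      qed
      ultimately show ?case by auto
    qed
  qed
  show ?thesis
  proof (rule that)
    show "pairing f c = 0" if "c \<in> B" for c using f[OF subsetD[OF WC subsetD[OF BW that]]] BW that by auto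
    show "pairing f z = 1" using f[OF z(1)] zW by simp
  qed
qed

text \<open>A 1-cycle that does not bound is separated from the boundaries by a cochain
  \<open>f\<close>. Vanishing on boundaries makes \<open>f\<close> a cocycle, so on edges it is the
  coboundary of some \<open>g\<close>, and such a cochain vanishes on every cycle.\<close>

lemma homologically_connectedI:
  assumes H0: "cycles X 0 \<subseteq> boundaries X 0"
    and cob: "\<And>f. (\<And>t. t \<in> simplices X 2 \<Longrightarrow> coboundary 2 f t = 0) \<Longrightarrow>
      \<exists>g. \<forall>e\<in>simplices X 1. f e = coboundary 1 g e"
  shows "homologically_connected X"
  unfolding homologically_connected_iff
proof (intro conjI H0 subsetI, rule ccontr)
  fix z assume z: "z \<in> cycles X 1" "z \<notin> boundaries X 1"
  have B: "boundaries X 1 = boundary 2 ` simplicial_chains X 2"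
    by (simp add: boundaries_def numeral_2_eq_2)
  have Bsub: "boundaries X 1 \<subseteq> simplicial_chains X 1"
    using boundary_chain by (auto simp: boundaries_def)
  have B0: "(\<lambda>s. 0) \<in> boundaries X 1"
    unfolding B by (rule image_eqI[OF _ chain_zero]) (simp add: boundary_zero)
  have Badd: "(\<lambda>s. c s + d s) \<in> boundaries X 1" if cd: "c \<in> boundaries X 1" "d \<in> boundaries X 1" for c d
  proof -
    obtain c' d' where "c' \<in> simplicial_chains X 2" "c = boundary 2 c'"
      "d' \<in> simplicial_chains X 2" "d = boundary 2 d'"
      using cd unfolding B by blast
    then show ?thesis
      unfolding B using boundary_add[of c' 2 d' 2] by (intro image_eqI[OF _ chain_add[of c' 2 d']]) simp_all
  qed
  have z1: "z \<in> simplicial_chains X 1" using z by (simp add: cycles_def)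
  obtain f where f: "\<And>c. c \<in> boundaries X 1 \<Longrightarrow> pairing f c = 0" "pairing f z = 1"
    using separating_cochain[OF Bsub B0 Badd z1 z(2)] by blast
  have "coboundary 2 f t = 0" if t: "t \<in> simplices X 2" for t
  proof -
    have "pairing f (boundary 2 (singleton_chain t)) = 0"
      using f(1) chain_singleton[OF t] unfolding B by blast
    then show ?thesis
      using pairing_boundary[OF chain_singleton[OF t]] pairing_singleton[of t] t simplex_subset
      by (simp add: simplices_def)
  qed
  then obtain g where g: "\<forall>e\<in>simplices X 1. f e = coboundary 1 g e"
    using cob by blast
  have "pairing f z = pairing (coboundary 1 g) z"
    unfolding pairing_def
  proof (rule sum.cong)
    fix s
    show "f s * z s = coboundary 1 g s * z s"
      using z1 g by (cases "z s") (auto simp: chain_iff)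
  qed simp
  also have "\<dots> = pairing g (boundary 1 z)"
    by (simp add: pairing_boundary[OF z1])
  also have "\<dots> = 0"
    using z by (simp add: cycles_def pairing_def)
  finally show False using f(2) by simp
qed

text \<open>Coning from \<open>r\<close>: the chain \<open>d\<close> of all edges
  \<open>{r, v}\<close>, weighted by the coefficient of \<open>v\<close>, has the right boundary at
  every \<open>v\<close> other than \<open>r\<close>, and also at \<open>r\<close> because the
  coefficients of a reduced cycle add up to 0.\<close>

lemma star_imp_zero_cycles_bound:
  assumes r: "r \<in> V" and star: "\<And>v. v \<in> V \<Longrightarrow> v \<noteq> r \<Longrightarrow> {r, v} \<in> X"
  shows "cycles X 0 \<subseteq> boundaries X 0"
proof
  fix c assume c: "c \<in> cycles X 0"
  then have ch: "c \<in> simplicial_chains X 0" and b0: "boundary 0 c = (\<lambda>s. 0)"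
    by (auto simp: cycles_def)
  define d where "d = (\<lambda>e. of_bool (card e = 2 \<and> r \<in> e \<and> e \<subseteq> V) * c (e - {r}))"
  have d: "d \<in> simplicial_chains X 1"
    unfolding chain_iff
  proof (intro allI impI)
    fix e assume "d e = 1"
    then have e: "card e = 2" "r \<in> e" "e \<subseteq> V"
      by (auto simp: d_def of_bool_def split: if_splits)
    then obtain v where "e = {r, v}" "v \<noteq> r"
      by (auto simp: card_2_iff)
    with e star show "e \<in> simplices X 1"
      by (auto simp: simplices_def)
  qed
  have c_out: "c s = 0" if "\<not> (\<exists>v\<in>V. s = {v})" for s
  proof (rule ccontr)
    assume "c s \<noteq> 0"
    then have "s \<in> simplices X 0" using ch by (simp add: chain_iff)
    then show False
      using that simplex_subset[of s] by (auto simp: simplices_def card_1_singleton_iff)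
  qed
  have sum_c: "(\<Sum>v\<in>V. c {v}) = 0"
  proof -
    have "(\<Sum>v\<in>V. c {v}) = (\<Sum>s\<in>(\<lambda>v. {v}) ` V. c s)"
      by (simp add: sum.reindex)
    also have "\<dots> = (\<Sum>s\<in>Pow V. c s)"
      by (rule sum.mono_neutral_left) (use finite_V c_out in auto)
    also have "\<dots> = boundary 0 c {}"
      by (simp add: boundary_eq[OF ch])
    finally show ?thesis by (simp add: b0)
  qed
  have "boundary 1 d = c"
  proof
    fix s
    show "boundary 1 d s = c s"
    proof (cases "\<exists>v\<in>V. s = {v}")
      case False
      have "boundary 1 d s = 0"
      proof (cases "card s = 1")
        case True
        then obtain v where "s = {v}" by (auto simp: card_1_singleton_iff)
        with False have "\<And>t. t \<in> Pow V \<Longrightarrow> \<not> s \<subseteq> t" by auto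
        then show ?thesis by (simp add: boundary_eq[OF d])
      qed (simp add: boundary_eq[OF d])
      then show ?thesis using c_out[OF False] by simp
    next
      case True
      then obtain v where v: "v \<in> V" "s = {v}" by blast
      have "boundary 1 d s = (\<Sum>t\<in>Pow V. of_bool (v \<in> t) * d t)"
        using v by (simp add: boundary_eq[OF d])
      also have "\<dots> = (\<Sum>t\<in>(\<lambda>w. {r, w}) ` (V - {r}). of_bool (v \<in> t) * d t)"
      proof (rule sum.mono_neutral_right)
        show "\<forall>t\<in>Pow V - (\<lambda>w. {r, w}) ` (V - {r}). of_bool (v \<in> t) * d t = 0"
        proof
          fix t assume t: "t \<in> Pow V - (\<lambda>w. {r, w}) ` (V - {r})"
          have "\<not> (card t = 2 \<and> r \<in> t)"
          proof
            assume "card t = 2 \<and> r \<in> t"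
            then obtain w where "t = {r, w}" "w \<noteq> r" by (auto simp: card_2_iff)
            with t show False by auto
          qed
          then show "of_bool (v \<in> t) * d t = 0" by (auto simp: d_def)
        qed
      qed (use finite_V r in auto)
      also have "\<dots> = (\<Sum>w\<in>V - {r}. of_bool (v \<in> {r, w}) * d {r, w})"
        by (subst sum.reindex) (auto simp: inj_on_def doubleton_eq_iff)
      also have "\<dots> = (\<Sum>w\<in>V - {r}. of_bool (v \<in> {r, w}) * c {w})"
      proof (rule sum.cong)
        fix w assume w: "w \<in> V - {r}"
        then have "{r, w} - {r} = {w}" "card {r, w} = 2" by auto
        with w r show "of_bool (v \<in> {r, w}) * d {r, w} = of_bool (v \<in> {r, w}) * c {w}"
          by (simp add: d_def)
      qed simp
      also have "\<dots> = c {v}"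
      proof (cases "v = r")
        case True
        have "(\<Sum>w\<in>V - {r}. c {w}) + c {r} = 0"
          using sum_c finite_V r by (simp add: sum.remove add.commute)
        then show ?thesis using True by (simp add: bit_add_eq_0_iff)
      next
        case False
        then have "(\<Sum>w\<in>V - {r}. of_bool (v \<in> {r, w}) * c {w}) = (\<Sum>w\<in>V - {r}. if v = w then c {w} else 0)"
          by (intro sum.cong) auto
        also have "\<dots> = c {v}"
          using False v finite_V by (simp add: sum.delta')
        finally show ?thesis .
      qed
      finally show ?thesis using v by simp
    qed
  qed
  with d show "c \<in> boundaries X 0"
    by (auto simp: boundaries_def)
qed

lemma isolated_not_homologically_connected:
  assumes "u \<in> V" "v \<in> V" "u \<noteq> v" "\<And>t. t \<in> simplices X 1 \<Longrightarrow> v \<notin> t"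
  shows "\<not> homologically_connected X"
proof
  assume "homologically_connected X"
  then obtain c where c: "c \<in> simplicial_chains X 1"
      "boundary 1 c = (\<lambda>s. singleton_chain {u} s + singleton_chain {v} s)"
    using vertex_difference_cycle[OF assms(1,2)]
    unfolding homologically_connected_iff boundaries_def One_nat_def[symmetric] by fastforce
  have "of_bool (v \<in> t) * c t = 0" for t
    using c(1) assms(4) by (cases "c t") (auto simp: chain_iff)
  then have "boundary 1 c {v} = 0"
    unfolding boundary_eq[OF c(1)] by (auto intro!: sum.neutral)
  then show False
    unfolding c(2) using assms(3) by (simp add: singleton_chain_def)
qed

end

section \<open>Events in random hypergraphs\<close>

lemma finite_triples [simp]: "finite (triples n)"
  by (rule finite_subset[of _ "Pow {1..n}"]) (auto simp: triples_def)

lemma finite_triple: "t \<in> triples n \<Longrightarrow> finite t"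
  by (auto simp: triples_def intro: finite_subset)

lemma set_pmf_random_hypergraph: "set_pmf (random_hypergraph n p) \<subseteq> Pow (triples n)"
  by (auto simp: random_hypergraph_def)

lemma prob_random_hypergraph:
  assumes p: "0 \<le> p" "p \<le> 1" and A: "A \<subseteq> triples n" and B: "B \<subseteq> triples n" and AB: "A \<inter> B = {}"
  shows "measure_pmf.prob (random_hypergraph n p) {E. A \<subseteq> E \<and> B \<inter> E = {}} = p ^ card A * (1 - p) ^ card B"
proof -
  define S where "S = (\<lambda>t. if t \<in> A then {True} else if t \<in> B then {False} else UNIV)"
  have "measure_pmf.prob (random_hypergraph n p) {E. A \<subseteq> E \<and> B \<inter> E = {}} =
      measure_pmf.prob (Pi_pmf (triples n) False (\<lambda>_. bernoulli_pmf p)) (Pi (triples n) S)"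
    unfolding random_hypergraph_def measure_map_pmf
    by (rule arg_cong[where f = "measure_pmf.prob _"]) (use A B AB in \<open>auto simp: S_def Pi_def\<close>)
  also have "\<dots> = (\<Prod>t\<in>triples n. measure_pmf.prob (bernoulli_pmf p) (S t))"
    by (simp add: measure_Pi_pmf_Pi)
  also have "\<dots> = (\<Prod>t\<in>triples n. (if t \<in> A then p else 1) * (if t \<in> B then 1 - p else 1))"
    using p AB by (intro prod.cong) (auto simp: S_def measure_pmf_single)
  also have "\<dots> = p ^ card A * (1 - p) ^ card B"
    using A B by (simp add: prod.distrib prod.If_cases Int_absorb1)
  finally show ?thesis .
qed

text \<open>Deterministic facts about complexes are proved for
  \<open>E \<subseteq> triples n\<close>; restricting to the support turns them into comparisons of
  probabilities.\<close>

lemma prob_random_hypergraph_mono: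
  assumes "\<And>E. E \<subseteq> triples n \<Longrightarrow> P E \<Longrightarrow> Q E"
  shows "measure_pmf.prob (random_hypergraph n p) {E. P E} \<le> measure_pmf.prob (random_hypergraph n p) {E. Q E}"
proof -
  have "measure_pmf.prob (random_hypergraph n p) {E. P E} =
      measure_pmf.prob (random_hypergraph n p) ({E. P E} \<inter> set_pmf (random_hypergraph n p))"
    by (simp add: measure_Int_set_pmf)
  also have "\<dots> \<le> measure_pmf.prob (random_hypergraph n p) {E. Q E}"
    by (intro measure_pmf.finite_measure_mono) (use assms set_pmf_random_hypergraph[of n p] in auto)
  finally show ?thesis .
qed

lemma prob_pmf_not: "measure_pmf.prob M {x. \<not> P x} = 1 - measure_pmf.prob M {x. P x}"
proof -
  have "{x. \<not> P x} = space (measure_pmf M) - {x. P x}" by auto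
  then show ?thesis using measure_pmf.prob_compl[of "{x. P x}" M] by simp
qed

lemma prob_pmf_union_le:
  "measure_pmf.prob M {x. P x \<or> Q x} \<le> measure_pmf.prob M {x. P x} + measure_pmf.prob M {x. Q x}"
  using measure_Un_le[of "{x. P x}" "measure_pmf M" "{x. Q x}"]
  by (simp add: Collect_disj_eq)

lemma prob_pmf_Bex_le:
  assumes "finite I"
  shows "measure_pmf.prob M {x. \<exists>i\<in>I. P i x} \<le> (\<Sum>i\<in>I. measure_pmf.prob M {x. P i x})"
proof -
  have "{x. \<exists>i\<in>I. P i x} = (\<Union>i\<in>I. {x. P i x})" by auto
  then show ?thesis
    using measure_pmf.finite_measure_subadditive_finite[OF assms, of "\<lambda>i. {x. P i x}" M] by simp
qed

section \<open>First and second moments of the number of occurring events\<close>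

lemma expectation_card_events:
  assumes "finite I"
  shows "measure_pmf.expectation M (\<lambda>x. real (card {i\<in>I. x \<in> A i})) = (\<Sum>i\<in>I. measure_pmf.prob M (A i))"
proof -
  have "real (card {i\<in>I. x \<in> A i}) = (\<Sum>i\<in>I. indicator (A i) x)" for x
  proof -
    have "(\<Sum>i\<in>I. indicator (A i) x) = (\<Sum>i\<in>{i\<in>I. x \<in> A i}. 1 :: real)"
      using assms by (intro sum.mono_neutral_cong_right) auto
    then show ?thesis by simp
  qed
  moreover have "integrable (measure_pmf M) (indicat_real (A i))" for i
    by (rule measure_pmf.integrable_const_bound[where B = 1]) auto
  ultimately show ?thesis
    by (simp add: Bochner_Integration.integral_sum)
qed

lemma markov_card_events:
  assumes "finite I" "a > 0"
  shows "measure_pmf.prob M {x. a \<le> real (card {i\<in>I. x \<in> A i})} \<le> (\<Sum>i\<in>I. measure_pmf.prob M (A i)) / a"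
proof -
  have b: "integrable (measure_pmf M) (\<lambda>x. real (card {i\<in>I. x \<in> A i}))"
    by (rule measure_pmf.integrable_const_bound[where B = "real (card I)"])
       (use assms in \<open>auto intro!: card_mono\<close>)
  show ?thesis
    using integral_Markov_inequality_measure[OF b, of "UNIV" a] assms
    by (simp add: expectation_card_events)
qed

text \<open>Chebyshev's inequality. The variance is at most \<mu> + (r - 1) \<mu>^2, the first term
  coming from the diagonal of the second moment, and is compared with (\<mu> / 2)^2. Concentration
  thus needs a large mean and a correlation factor \<open>r\<close> close to 1.\<close>

lemma second_moment_card_events:
  fixes M :: "'a pmf" and A :: "'i \<Rightarrow> 'a set"
  defines "\<mu> \<equiv> \<lambda>I. \<Sum>i\<in>I. measure_pmf.prob M (A i)"
  assumes fin: "finite I" and pos: "\<mu> I > 0"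
    and corr: "\<And>i j. i \<in> I \<Longrightarrow> j \<in> I \<Longrightarrow> i \<noteq> j \<Longrightarrow>
      measure_pmf.prob M (A i \<inter> A j) \<le> r * (measure_pmf.prob M (A i) * measure_pmf.prob M (A j))"
    and r: "r \<ge> 0"
  shows "measure_pmf.prob M {x. real (card {i\<in>I. x \<in> A i}) \<le> \<mu> I / 2} \<le> 4 * (1 / \<mu> I + (r - 1))"
proof -
  let ?P = "measure_pmf.prob M"
  define X where "X = (\<lambda>x. real (card {i\<in>I. x \<in> A i}))"
  have X_le: "X x \<le> card I" and X_ge: "0 \<le> X x" for x
    using fin by (auto simp: X_def intro!: card_mono)
  have intX: "integrable (measure_pmf M) X"
    by (rule measure_pmf.integrable_const_bound[where B = "real (card I)"]) (use X_le X_ge in auto)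
  have intX2: "integrable (measure_pmf M) (\<lambda>x. (X x)\<^sup>2)"
    by (rule measure_pmf.integrable_const_bound[where B = "(real (card I))\<^sup>2"])
       (use X_le X_ge in \<open>auto intro!: power_mono\<close>)
  have EX: "measure_pmf.expectation M X = \<mu> I"
    unfolding X_def \<mu>_def by (rule expectation_card_events[OF fin])
  have X2: "(X x)\<^sup>2 = real (card {ij\<in>I \<times> I. x \<in> A (fst ij) \<inter> A (snd ij)})" for x
  proof -
    have "{ij\<in>I \<times> I. x \<in> A (fst ij) \<inter> A (snd ij)} = {i\<in>I. x \<in> A i} \<times> {i\<in>I. x \<in> A i}" by auto
    then show ?thesis by (simp add: X_def card_cartesian_product power2_eq_square)
  qed
  have "measure_pmf.expectation M (\<lambda>x. (X x)\<^sup>2) = (\<Sum>ij\<in>I\<times>I. ?P (A (fst ij) \<inter> A (snd ij)))"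
    unfolding X2 using fin by (intro expectation_card_events) simp
  also have "\<dots> = (\<Sum>i\<in>I. \<Sum>j\<in>I. ?P (A i \<inter> A j))"
    by (simp add: sum.cartesian_product case_prod_beta)
  also have "\<dots> \<le> (\<Sum>i\<in>I. \<Sum>j\<in>I. (if i = j then ?P (A i) else 0) + r * (?P (A i) * ?P (A j)))"
  proof (intro sum_mono)
    fix i j assume "i \<in> I" "j \<in> I"
    then show "?P (A i \<inter> A j) \<le> (if i = j then ?P (A i) else 0) + r * (?P (A i) * ?P (A j))"
      using corr[of i j] r by (cases "i = j") auto
  qed
  also have "\<dots> = \<mu> I + r * (\<mu> I)\<^sup>2"
    using fin by (simp add: sum.distrib sum.delta' \<mu>_def power2_eq_square sum_product
        flip: sum_distrib_left)
  finally have E2: "measure_pmf.expectation M (\<lambda>x. (X x)\<^sup>2) \<le> \<mu> I + r * (\<mu> I)\<^sup>2" .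
  have "measure_pmf.variance M X =
      measure_pmf.expectation M (\<lambda>x. (X x)\<^sup>2) - (measure_pmf.expectation M X)\<^sup>2"
    by (rule measure_pmf.variance_eq[OF intX intX2])
  also have "\<dots> \<le> \<mu> I + (r - 1) * (\<mu> I)\<^sup>2"
    using E2 by (simp add: EX algebra_simps)
  finally have var: "measure_pmf.variance M X \<le> \<mu> I + (r - 1) * (\<mu> I)\<^sup>2" .
  have "?P {x. X x \<le> \<mu> I / 2} \<le> ?P {x \<in> space M. \<mu> I / 2 \<le> \<bar>X x - measure_pmf.expectation M X\<bar>}"
    unfolding EX by (intro measure_pmf.finite_measure_mono) (use pos in \<open>auto simp: abs_if\<close>)
  also have "\<dots> \<le> measure_pmf.variance M X / (\<mu> I / 2)\<^sup>2"
    by (rule measure_pmf.Chebyshev_inequality) (use intX2 pos in auto)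
  also have "\<dots> \<le> (\<mu> I + (r - 1) * (\<mu> I)\<^sup>2) / (\<mu> I / 2)\<^sup>2"
    using var by (intro divide_right_mono) auto
  also have "\<dots> = 4 * (1 / \<mu> I + (r - 1))"
    using pos by (simp add: field_simps power2_eq_square)
  finally show ?thesis by (simp add: X_def)
qed

text \<open>Unless one event requires what the other forbids, the joint event counts a triple
  forbidden by both only once, which accounts for the factor. The required triples are disjoint and
  cause no correlation.\<close>

lemma prob_random_hypergraph_corr:
  assumes p: "0 \<le> p" "p < 1"
    and A: "A \<subseteq> triples n" "A' \<subseteq> triples n" "A \<inter> A' = {}"
    and B: "B \<subseteq> triples n" "B' \<subseteq> triples n" "A \<inter> B = {}" "A' \<inter> B' = {}"
    and k: "card (B \<inter> B') \<le> k"
  shows "measure_pmf.prob (random_hypergraph n p)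
      ({E. A \<subseteq> E \<and> B \<inter> E = {}} \<inter> {E. A' \<subseteq> E \<and> B' \<inter> E = {}})
    \<le> (1 / (1 - p) ^ k) * (measure_pmf.prob (random_hypergraph n p) {E. A \<subseteq> E \<and> B \<inter> E = {}} *
        measure_pmf.prob (random_hypergraph n p) {E. A' \<subseteq> E \<and> B' \<inter> E = {}})"
    (is "?lhs \<le> _")
proof (cases "A \<inter> B' = {} \<and> A' \<inter> B = {}")
  case False
  let ?P = "measure_pmf.prob (random_hypergraph n p)"
  from False have "{E. A \<subseteq> E \<and> B \<inter> E = {}} \<inter> {E. A' \<subseteq> E \<and> B' \<inter> E = {}} = {}" by blast
  then have "?P ({E. A \<subseteq> E \<and> B \<inter> E = {}} \<inter> {E. A' \<subseteq> E \<and> B' \<inter> E = {}}) = 0"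
    by (simp only: measure_empty)
  then show ?thesis using p by simp
next
  case True
  let ?P = "measure_pmf.prob (random_hypergraph n p)"
  have fin: "finite A" "finite A'" "finite B" "finite B'"
    using A B by (auto intro: finite_subset[OF _ finite_triples])
  have eq: "{E. A \<subseteq> E \<and> B \<inter> E = {}} \<inter> {E. A' \<subseteq> E \<and> B' \<inter> E = {}} =
      {E. A \<union> A' \<subseteq> E \<and> (B \<union> B') \<inter> E = {}}" by blast
  have "?P ({E. A \<subseteq> E \<and> B \<inter> E = {}} \<inter> {E. A' \<subseteq> E \<and> B' \<inter> E = {}}) =
      p ^ card (A \<union> A') * (1 - p) ^ card (B \<union> B')"
    unfolding eq by (rule prob_random_hypergraph) (use p A B True in auto)
  also have "card (A \<union> A') = card A + card A'"
    using A fin by (simp add: card_Un_disjoint)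
  also have "(1 - p) ^ card (B \<union> B') = (1 - p) ^ card B * (1 - p) ^ card B' / (1 - p) ^ card (B \<inter> B')"
    using card_Un_Int[OF fin(3,4)] p by (simp add: power_add[symmetric] field_simps)
  also have "\<dots> \<le> (1 - p) ^ card B * (1 - p) ^ card B' / (1 - p) ^ k"
    using p k by (intro divide_left_mono mult_pos_pos power_decreasing) auto
  finally have "?P ({E. A \<subseteq> E \<and> B \<inter> E = {}} \<inter> {E. A' \<subseteq> E \<and> B' \<inter> E = {}}) \<le>
      p ^ (card A + card A') * ((1 - p) ^ card B * (1 - p) ^ card B' / (1 - p) ^ k)"
    using p by (simp add: mult_left_mono)
  also have "\<dots> = (1 / (1 - p) ^ k) * (?P {E. A \<subseteq> E \<and> B \<inter> E = {}} * ?P {E. A' \<subseteq> E \<and> B' \<inter> E = {}})"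
    using p A B by (simp add: prob_random_hypergraph power_add mult_ac)
  finally show ?thesis .
qed

section \<open>Cocycles of hypergraph complexes\<close>

definition shadow :: "nat set set \<Rightarrow> nat set set" where
  "shadow E = {e. card e = 2 \<and> (\<exists>t\<in>E. e \<subseteq> t)}"

text \<open>On pairs this is the set of edges leaving \<open>S\<close>, the support of the
  coboundary of its indicator function.\<close>

definition vertex_cut :: "'a set \<Rightarrow> 'a set set" where
  "vertex_cut S = {e. card (e \<inter> S) = 1}"

lemma doubleton_in_cut_iff: "u \<noteq> v \<Longrightarrow> {u, v} \<in> vertex_cut S \<longleftrightarrow> (u \<in> S \<longleftrightarrow> v \<notin> S)"
  by (auto simp: vertex_cut_def Int_insert_left)

lemma finite_complex_hypergraph:
  assumes "E \<subseteq> triples n"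
  shows "finite_complex {1..n} (hypergraph_complex n E)"
proof
  show "s \<in> hypergraph_complex n E" if "t \<in> hypergraph_complex n E" "s \<subseteq> t" "s \<noteq> {}" for s t
    using that unfolding hypergraph_complex_def by simp (metis order_trans subset_singleton_iff)
qed (use assms in \<open>auto simp: hypergraph_complex_def triples_def\<close>)

lemma simplices_1_hypergraph_complex: "simplices (hypergraph_complex n E) 1 = shadow E"
proof -
  have "s \<noteq> {}" "s \<noteq> {v}" if "card s = 2" for s :: "nat set" and v
    using that by auto
  then show ?thesis
    unfolding simplices_def hypergraph_complex_def shadow_def by (auto simp: numeral_2_eq_2)
qed

lemma simplices_2_hypergraph_complex:
  assumes "E \<subseteq> triples n"
  shows "simplices (hypergraph_complex n E) 2 = E"
proof -
  have "s \<in> E" if "s \<subseteq> t" "t \<in> E" "card s = 3" for s t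
  proof -
    have "card t = 3" using that assms by (auto simp: triples_def)
    then have "s = t"
      using that by (intro card_subset_eq) (auto intro: card_ge_0_finite)
    with that show ?thesis by simp
  qed
  moreover have "card t = 3 \<and> t \<noteq> {}" if "t \<in> E" for t
    using that assms by (auto simp: triples_def)
  ultimately show ?thesis
    by (auto simp: simplices_def hypergraph_complex_def)
qed

lemma shadow_subset:
  assumes "E \<subseteq> triples n" "e \<in> shadow E"
  shows "e \<subseteq> {1..n}" "card e = 2"
proof -
  obtain t where t: "t \<in> E" "e \<subseteq> t" "card e = 2"
    using assms(2) by (auto simp: shadow_def)
  then have "t \<in> triples n" using assms(1) by blast
  with t show "e \<subseteq> {1..n}" "card e = 2" by (auto simp: triples_def)
qed

lemma coboundary_2_of_set:
  assumes "\<And>e. e \<in> G \<Longrightarrow> card e = 2" "finite t"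
  shows "coboundary 2 (\<lambda>e. of_bool (e \<in> G)) t = of_bool (odd (card {e\<in>G. e \<subseteq> t}))"
proof -
  have "{s \<in> {s. s \<subseteq> t \<and> card s = 2}. (of_bool (s \<in> G) :: bit) = 1} = {e\<in>G. e \<subseteq> t}"
    using assms by auto
  then show ?thesis
    unfolding coboundary_def using assms(2) by (subst sum_bit_eq_parity) simp_all
qed

text \<open>Cocycles and potentials in the language of edge sets: \<open>G\<close> stands for its
  indicator cochain, and \<open>S\<close> is the set of vertices where the potential is 1.\<close>

lemma even_edge_set_is_cut:
  assumes E: "E \<subseteq> triples n" and hc: "homologically_connected (hypergraph_complex n E)"
    and G: "G \<subseteq> shadow E" and even: "\<And>t. t \<in> E \<Longrightarrow> even (card {e\<in>G. e \<subseteq> t})"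
  obtains S where "S \<subseteq> {1..n}" "\<And>e. e \<in> shadow E \<Longrightarrow> e \<in> G \<longleftrightarrow> e \<in> vertex_cut S"
proof -
  interpret finite_complex "{1..n}" "hypergraph_complex n E"
    by (rule finite_complex_hypergraph[OF E])
  have fin: "finite t" if "t \<in> E" for t
    using that E finite_triple by blast
  have card_G: "\<And>e. e \<in> G \<Longrightarrow> card e = 2"
    using G shadow_subset[OF E] by blast
  obtain g where g: "\<And>e. e \<in> shadow E \<Longrightarrow> of_bool (e \<in> G) = coboundary 1 g e"
    using cocycle_imp_coboundary[OF hc, of "\<lambda>e. of_bool (e \<in> G)"] even coboundary_2_of_set[OF card_G fin]
    unfolding simplices_1_hypergraph_complex simplices_2_hypergraph_complex[OF E] by auto
  show ?thesis
  proof (rule that[of "{v\<in>{1..n}. g {v} = 1}"])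
    fix e assume e: "e \<in> shadow E"
    then obtain u v where uv: "e = {u, v}" "u \<noteq> v"
      using shadow_subset[OF E e] by (auto simp: card_2_iff)
    have "u \<in> {1..n}" "v \<in> {1..n}"
      using shadow_subset[OF E e] uv by auto
    moreover have "of_bool (e \<in> G) = g {u} + g {v}"
      using g[OF e] unfolding uv(1) coboundary_edge[OF uv(2)] .
    ultimately show "e \<in> G \<longleftrightarrow> e \<in> vertex_cut {v\<in>{1..n}. g {v} = 1}"
      unfolding uv(1) doubleton_in_cut_iff[OF uv(2)] by (cases "g {u}"; cases "g {v}") auto
  qed auto
qed

text \<open>Only the support of a cochain inside the shadow matters, so cocycles may be taken as
  sets of shadow edges. The star at \<open>r\<close> settles dimension 0.\<close>

lemma homologically_connected_hypergraphI:
  assumes E: "E \<subseteq> triples n" and r: "r \<in> {1..n}"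
    and star: "\<And>v. v \<in> {1..n} \<Longrightarrow> v \<noteq> r \<Longrightarrow> {r, v} \<in> shadow E"
    and cuts: "\<And>G. G \<subseteq> shadow E \<Longrightarrow> (\<And>t. t \<in> E \<Longrightarrow> even (card {e\<in>G. e \<subseteq> t})) \<Longrightarrow>
      \<exists>S. \<forall>e\<in>shadow E. e \<in> G \<longleftrightarrow> e \<in> vertex_cut S"
  shows "homologically_connected (hypergraph_complex n E)"
proof -
  interpret finite_complex "{1..n}" "hypergraph_complex n E"
    by (rule finite_complex_hypergraph[OF E])
  have fin: "finite t" if "t \<in> E" for t
    using that E finite_triple by blast
  show ?thesis
  proof (rule homologically_connectedI)
    show "cycles (hypergraph_complex n E) 0 \<subseteq> boundaries (hypergraph_complex n E) 0"
    proof (rule star_imp_zero_cycles_bound[OF r])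
      fix v assume "v \<in> {1..n}" "v \<noteq> r"
      then show "{r, v} \<in> hypergraph_complex n E"
        using star[of v] by (auto simp: shadow_def hypergraph_complex_def)
    qed
    fix f :: "nat set \<Rightarrow> bit"
    assume "\<And>t. t \<in> simplices (hypergraph_complex n E) 2 \<Longrightarrow> coboundary 2 f t = 0"
    then have f: "\<And>t. t \<in> E \<Longrightarrow> coboundary 2 f t = 0"
      by (simp add: simplices_2_hypergraph_complex[OF E])
    define G where "G = {e\<in>shadow E. f e = 1}"
    have "even (card {e\<in>G. e \<subseteq> t})" if t: "t \<in> E" for t
    proof -
      have "{s \<in> {s. s \<subseteq> t \<and> card s = 2}. f s = 1} = {e\<in>G. e \<subseteq> t}"
        using t by (auto simp: G_def shadow_def)
      then have "coboundary 2 f t = of_bool (odd (card {e\<in>G. e \<subseteq> t}))"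
        unfolding coboundary_def using fin[OF t] by (subst sum_bit_eq_parity) simp_all
      with f[OF t] show ?thesis by simp
    qed
    then obtain S where S: "\<forall>e\<in>shadow E. e \<in> G \<longleftrightarrow> e \<in> vertex_cut S"
      using cuts[of G] by (auto simp: G_def)
    define g where "g = (\<lambda>s. of_bool (the_elem s \<in> S) :: bit)"
    have "f e = coboundary 1 g e" if e: "e \<in> shadow E" for e
    proof -
      obtain u v where uv: "e = {u, v}" "u \<noteq> v"
        using shadow_subset[OF E e] by (auto simp: card_2_iff)
      have "e \<in> G \<longleftrightarrow> f e = 1" using e by (simp add: G_def)
      then have "f e = 1 \<longleftrightarrow> (u \<in> S \<longleftrightarrow> v \<notin> S)"
        using S e doubleton_in_cut_iff[OF uv(2)] uv(1) by blast
      then show ?thesis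
        unfolding uv(1) coboundary_edge[OF uv(2)] g_def by (cases "f {u, v}") auto
    qed
    then show "\<exists>g. \<forall>e\<in>simplices (hypergraph_complex n E) 1. f e = coboundary 1 g e"
      unfolding simplices_1_hypergraph_complex by blast
  qed
qed

lemma isolated_vertex_not_connected:
  assumes E: "E \<subseteq> triples n" and v: "v \<in> {1..n}" and n: "n \<ge> 2"
    and iso: "{t\<in>triples n. v \<in> t} \<inter> E = {}"
  shows "\<not> homologically_connected (hypergraph_complex n E)"
proof -
  interpret finite_complex "{1..n}" "hypergraph_complex n E"
    by (rule finite_complex_hypergraph[OF E])
  obtain u where "u \<in> {1..n}" "u \<noteq> v"
    using n by (cases "v = 1") (auto intro: that[of 1] that[of 2])
  moreover have "v \<notin> e" if "e \<in> simplices (hypergraph_complex n E) 1" for e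
    using that iso E unfolding simplices_1_hypergraph_complex by (auto simp: shadow_def)
  ultimately show ?thesis
    using isolated_not_homologically_connected[of u v] v by blast
qed

text \<open>
  If \<open>t\<close> is the only face containing either of its two edges at the vertex \<open>Min t\<close>,
  then these two edges form a cocycle.
\<close>

definition apex_edges :: "nat set \<Rightarrow> nat set set" where
  "apex_edges t = {e. e \<subseteq> t \<and> card e = 2 \<and> Min t \<in> e}"

definition blockers :: "nat \<Rightarrow> nat set \<Rightarrow> nat set set" where
  "blockers n t = {s\<in>triples n. s \<noteq> t \<and> (\<exists>e\<in>apex_edges t. e \<subseteq> s)}"

text \<open>The minimum is an arbitrary way of singling out one vertex of \<open>t\<close>, so that
  each triple carries one candidate cocycle. Two pendant triples, that is, faces none of whose
  blockers is a face, never share an apex edge, since they would block each other.\<close>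

lemma triple_apex:
  assumes "t \<in> triples n"
  obtains u v w where "t = {u, v, w}" "u \<noteq> v" "u \<noteq> w" "v \<noteq> w" "apex_edges t = {{u, v}, {u, w}}"
    "u \<in> {1..n}" "v \<in> {1..n}" "w \<in> {1..n}"
proof -
  have t: "card t = 3" "finite t" "t \<subseteq> {1..n}"
    using assms finite_triple[OF assms] by (auto simp: triples_def)
  then have M: "Min t \<in> t" by (intro Min_in) auto
  then have "card (t - {Min t}) = 2" using t by simp
  then obtain v w where vw: "t - {Min t} = {v, w}" "v \<noteq> w"
    by (auto simp: card_2_iff)
  have eq: "t = {Min t, v, w}" using vw M by blast
  have ne: "Min t \<noteq> v" "Min t \<noteq> w" using vw by auto
  have "e = {Min t, v} \<or> e = {Min t, w}" if e: "e \<subseteq> t" "card e = 2" "Min t \<in> e" for e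
  proof -
    obtain x where "e = {Min t, x}" "x \<noteq> Min t"
      using e by (auto simp: card_2_iff)
    moreover from this e have "x \<in> {v, w}" using vw by auto
    ultimately show ?thesis by auto
  qed
  moreover have "{Min t, v} \<subseteq> t" "{Min t, w} \<subseteq> t" using eq by blast+
  ultimately have "apex_edges t = {{Min t, v}, {Min t, w}}"
    using ne unfolding apex_edges_def by auto
  then show ?thesis
    using that[of "Min t" v w] eq ne vw t by blast
qed

section \<open>Counting the triples that block a pendant triple\<close>

lemma card_apex_edges:
  assumes "t \<in> triples n"
  shows "card (apex_edges t) = 2"
proof -
  obtain u v w where "u \<noteq> v" "u \<noteq> w" "v \<noteq> w" "apex_edges t = {{u, v}, {u, w}}"
    using triple_apex[OF assms] by metis
  then show ?thesis by (auto simp: doubleton_eq_iff)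
qed

lemma triple_insert:
  assumes "s \<in> triples n" "e \<subseteq> s" "card e = 2"
  obtains z where "z \<in> {1..n}" "s = insert z e"
proof -
  have "card (s - e) = 1"
    using assms finite_triple[OF assms(1)] by (simp add: card_Diff_subset finite_subset triples_def)
  then obtain z where z: "s - e = {z}" by (auto simp: card_1_singleton_iff)
  then have "z \<in> s" by blast
  then have "z \<in> {1..n}" using assms(1) by (auto simp: triples_def)
  moreover have "s = insert z e" using z assms(2) by blast
  ultimately show ?thesis using that by blast
qed

text \<open>Each of the two apex edges extends to a triple in at most n ways. Using 2 n in place of
  the exact 2 (n - 3) costs only a bounded factor in the expectation for the small \<open>p\<close>
  considered.\<close>

lemma card_blockers_le:
  assumes "t \<in> triples n"
  shows "card (blockers n t) \<le> 2 * n"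
proof -
  obtain u v w where t: "u \<noteq> v" "u \<noteq> w" "apex_edges t = {{u, v}, {u, w}}"
    using triple_apex[OF assms] by metis
  have "blockers n t \<subseteq> (\<lambda>z. insert z {u, v}) ` {1..n} \<union> (\<lambda>z. insert z {u, w}) ` {1..n}"
  proof
    fix s assume "s \<in> blockers n t"
    then obtain e where e: "s \<in> triples n" "e \<subseteq> s" "e = {u, v} \<or> e = {u, w}"
      unfolding blockers_def t(3) by blast
    then have "card e = 2" using t by auto
    then obtain z where "z \<in> {1..n}" "s = insert z e" using triple_insert e by blast
    with e(3) show "s \<in> (\<lambda>z. insert z {u, v}) ` {1..n} \<union> (\<lambda>z. insert z {u, w}) ` {1..n}"
      by blast
  qed
  then have "card (blockers n t) \<le> card ((\<lambda>z. insert z {u, v}) ` {1..n} \<union> (\<lambda>z. insert z {u, w}) ` {1..n})"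
    by (intro card_mono) auto
  also have "\<dots> \<le> card ((\<lambda>z. insert z {u, v}) ` {1..n}) + card ((\<lambda>z. insert z {u, w}) ` {1..n})"
    by (rule card_Un_le)
  also have "\<dots> \<le> n + n"
    using card_image_le[of "{1..n}" "\<lambda>z. insert z {u, v}"] card_image_le[of "{1..n}" "\<lambda>z. insert z {u, w}"]
    by simp
  finally show ?thesis by simp
qed

lemma union_of_two_edges:
  assumes "card t = 3" "e \<subseteq> t" "f \<subseteq> t" "card e = 2" "card f = 2" "e \<noteq> f"
  shows "e \<union> f = t"
proof -
  have fin: "finite t" "finite e" "finite f" using assms by (auto intro: card_ge_0_finite)
  have "\<not> f \<subseteq> e" using assms fin by (metis card_subset_eq)
  then have "e \<subset> e \<union> f" by blast
  then have "card e < card (e \<union> f)" using fin by (intro psubset_card_mono) auto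
  then show ?thesis using assms fin by (intro card_seteq) auto
qed

text \<open>A common blocker contains an apex edge of \<open>t\<close> and a different one of
  \<open>t'\<close>, hence is their union, with 2 * 2 choices. The bound becomes the exponent in the
  correlation of two pendant events.\<close>

lemma card_blockers_Int_le:
  assumes "t \<in> triples n" "t' \<in> triples n" "apex_edges t \<inter> apex_edges t' = {}"
  shows "card (blockers n t \<inter> blockers n t') \<le> 4"
proof -
  have fin: "finite (apex_edges t) \<and> card (apex_edges t) \<le> 2" if "t \<in> triples n" for t
    using card_apex_edges[OF that] by (simp add: card_ge_0_finite)
  have "s \<in> (\<lambda>(e, e'). e \<union> e') ` (apex_edges t \<times> apex_edges t')"
    if s: "s \<in> blockers n t" "s \<in> blockers n t'" for s
  proof -
    obtain e e' where e: "e \<in> apex_edges t" "e \<subseteq> s" "e' \<in> apex_edges t'" "e' \<subseteq> s"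
      using s by (auto simp: blockers_def)
    have "e \<union> e' = s"
    proof (rule union_of_two_edges)
      show "card s = 3" using s by (auto simp: blockers_def triples_def)
    qed (use e assms(3) in \<open>auto simp: apex_edges_def\<close>)
    then show ?thesis using e by force
  qed
  then have "card (blockers n t \<inter> blockers n t') \<le> card ((\<lambda>(e, e'). e \<union> e') ` (apex_edges t \<times> apex_edges t'))"
    using fin[OF assms(1)] fin[OF assms(2)] by (intro card_mono) auto
  also have "\<dots> \<le> card (apex_edges t \<times> apex_edges t')"
    using fin[OF assms(1)] fin[OF assms(2)] by (intro card_image_le) auto
  also have "\<dots> \<le> 2 * 2"
    unfolding card_cartesian_product using fin[OF assms(1)] fin[OF assms(2)] by (intro mult_mono) auto
  finally show ?thesis by simp
qed

text \<open>
  Distinct sets of such faces give distinct cocycles, while there are at most \<open>2 ^ n\<close> coboundaries.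
\<close>

lemma pendant_triples_le:
  assumes E: "E \<subseteq> triples n" and hc: "homologically_connected (hypergraph_complex n E)"
  shows "card {t\<in>triples n. t \<in> E \<and> blockers n t \<inter> E = {}} \<le> n"
proof -
  define D where "D = {t\<in>triples n. t \<in> E \<and> blockers n t \<inter> E = {}}"
  \<comment> \<open>The only face through an apex edge of \<open>t \<in> D\<close> is
    \<open>t\<close>, so a face contains exactly two edges of \<open>G C\<close> or none.\<close>
  have only: "s = t" if "t \<in> D" "e \<in> apex_edges t" "e \<subseteq> s" "s \<in> E" for s t e
    using that E by (auto simp: D_def blockers_def)
  define G where "G = (\<lambda>C. \<Union>t\<in>C. apex_edges t)"
  have Gsub: "G C \<subseteq> shadow E" if "C \<subseteq> D" for C
    using that by (auto simp: G_def D_def apex_edges_def shadow_def)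
  have Geven: "even (card {e\<in>G C. e \<subseteq> s})" if C: "C \<subseteq> D" and s: "s \<in> E" for C s
  proof (cases "s \<in> C")
    case True
    have "{e\<in>G C. e \<subseteq> s} \<subseteq> apex_edges s"
    proof
      fix e assume "e \<in> {e\<in>G C. e \<subseteq> s}"
      then obtain t where "t \<in> C" "e \<in> apex_edges t" "e \<subseteq> s" by (auto simp: G_def)
      with only[of t e s] C s show "e \<in> apex_edges s" by blast
    qed
    moreover have "apex_edges s \<subseteq> {e\<in>G C. e \<subseteq> s}"
      using True by (auto simp: G_def apex_edges_def)
    ultimately have "{e\<in>G C. e \<subseteq> s} = apex_edges s" by blast
    moreover have "s \<in> triples n" using s E by blast
    then have "card (apex_edges s) = 2"
      by (rule card_apex_edges)
    ultimately show ?thesis by simp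
  next
    case False
    have "{e\<in>G C. e \<subseteq> s} = {}"
    proof (rule equals0I)
      fix e assume "e \<in> {e\<in>G C. e \<subseteq> s}"
      then obtain t where "t \<in> C" "e \<in> apex_edges t" "e \<subseteq> s" by (auto simp: G_def)
      with only[of t e s] C s False show False by blast
    qed
    then show ?thesis by (simp only: card.empty even_zero)
  qed
  have "\<exists>S. S \<subseteq> {1..n} \<and> (\<forall>e\<in>shadow E. e \<in> G C \<longleftrightarrow> e \<in> vertex_cut S)" if "C \<subseteq> D" for C
    using even_edge_set_is_cut[OF E hc Gsub[OF that] Geven[OF that]] by metis
  then obtain S where S: "\<And>C. C \<subseteq> D \<Longrightarrow> S C \<subseteq> {1..n}"
    "\<And>C e. C \<subseteq> D \<Longrightarrow> e \<in> shadow E \<Longrightarrow> e \<in> G C \<longleftrightarrow> e \<in> vertex_cut (S C)"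
    by metis
  \<comment> \<open>Injectivity of the map from sets of pendant triples to cuts: an edge of
    \<open>G C\<close> determines the face it came from.\<close>
  have sub: "C \<subseteq> C'" if C: "C \<subseteq> D" "C' \<subseteq> D" "S C = S C'" for C C'
  proof
    fix t assume t: "t \<in> C"
    then have "t \<in> triples n" "t \<in> E" using C by (auto simp: D_def)
    then obtain e where e: "e \<in> apex_edges t"
      using card_apex_edges[of t n] by (auto simp: card_2_iff)
    have "e \<in> G C" using e t by (auto simp: G_def)
    moreover have "e \<in> shadow E" using Gsub[OF C(1)] \<open>e \<in> G C\<close> by blast
    ultimately have "e \<in> G C'" using S(2) C by metis
    then obtain t' where t': "t' \<in> C'" "e \<in> apex_edges t'" by (auto simp: G_def)
    have "t = t'"
      using only[of t' e t] t' C e \<open>t \<in> E\<close> by (auto simp: apex_edges_def)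
    with t' show "t \<in> C'" by simp
  qed
  have "inj_on S (Pow D)"
    by (rule inj_onI) (use sub in blast)
  then have "card (Pow D) \<le> card (Pow {1..n})"
    by (rule card_inj_on_le) (use S(1) in auto)
  moreover have "finite D" by (simp add: D_def)
  ultimately have "(2::nat) ^ card D \<le> 2 ^ n"
    by (simp add: card_Pow)
  then show ?thesis by (simp add: D_def)
qed

text \<open>Let \<open>u\<close> be the apex of \<open>t\<close> and \<open>x\<close> a vertex
  outside \<open>t\<close>. If some \<open>{u, x, y}\<close> and some \<open>{v, x, y'}\<close> are
  faces, the shadow contains the triangle on \<open>u\<close>, \<open>v\<close>, \<open>x\<close>,
  in which \<open>{u, v}\<close> is the only apex edge, whereas a cut meets a triangle in an even
  number of edges. So connectedness forces one of the families \<open>Q\<close>, \<open>Q'\<close>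
  to be missed. For the n - 4 choices of \<open>y\<close> outside \<open>t\<close> and different
  from \<open>x\<close>, these triples contain no apex edge, which makes them independent of the
  pendant event.\<close>

lemma pendant_triple_witnesses:
  assumes t: "t \<in> triples n" and n: "n \<ge> 4"
  shows "\<exists>Q Q'. Q \<subseteq> triples n - insert t (blockers n t) \<and> Q' \<subseteq> triples n - insert t (blockers n t) \<and>
    n - 4 \<le> card Q \<and> n - 4 \<le> card Q' \<and>
    (\<forall>E. E \<subseteq> triples n \<longrightarrow> t \<in> E \<longrightarrow> blockers n t \<inter> E = {} \<longrightarrow>
      homologically_connected (hypergraph_complex n E) \<longrightarrow> Q \<inter> E = {} \<or> Q' \<inter> E = {})"
proof -
  obtain u v w where t_eq: "t = {u, v, w}" "u \<noteq> v" "u \<noteq> w" "v \<noteq> w" "apex_edges t = {{u, v}, {u, w}}"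
    and un: "u \<in> {1..n}" "v \<in> {1..n}" "w \<in> {1..n}"
    using triple_apex[OF t] by metis
  have "card ({1..n} - t) = n - 3"
    using t finite_triple[OF t] by (subst card_Diff_subset) (auto simp: triples_def)
  then have "card ({1..n} - t) > 0" using n by simp
  then have "{1..n} - t \<noteq> {}" unfolding card_gt_0_iff by (rule conjunct1)
  then obtain x where x: "x \<in> {1..n}" "x \<notin> t" by blast
  define R where "R = {1..n} - {u, v, w, x}"
  have cR: "card R = n - 4" "finite R"
    using t_eq un x unfolding R_def by (subst card_Diff_subset) auto
  define Q where "Q = (\<lambda>y. {u, x, y}) ` R"
  define Q' where "Q' = (\<lambda>y. {v, x, y}) ` R"
  have inj: "inj_on (\<lambda>y. {a, x, y}) R" if "a \<in> {u, v}" for a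
    using that by (auto simp: inj_on_def R_def)
  have card: "card Q = n - 4" "card Q' = n - 4"
    unfolding Q_def Q'_def using inj cR by (auto simp: card_image)
  have mem: "{a, x, y} \<in> triples n" if "a \<in> {u, v}" "y \<in> R" for a y
    using that x t_eq un by (auto simp: triples_def R_def card_insert_if)
  have sub: "Q \<subseteq> triples n - insert t (blockers n t)" "Q' \<subseteq> triples n - insert t (blockers n t)"
  proof -
    have "{a, x, y} \<notin> insert t (blockers n t)" if a: "a \<in> {u, v}" and y: "y \<in> R" for a y
    proof -
      have "\<not> {u, v} \<subseteq> {a, x, y}" "\<not> {u, w} \<subseteq> {a, x, y}"
        using a y x t_eq(1-4) by (auto simp: R_def)
      then show ?thesis using x by (auto simp: blockers_def t_eq(5))
    qed
    then show "Q \<subseteq> triples n - insert t (blockers n t)" "Q' \<subseteq> triples n - insert t (blockers n t)"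
      using mem by (auto simp: Q_def Q'_def)
  qed
  have "Q \<inter> E = {} \<or> Q' \<inter> E = {}"
    if E: "E \<subseteq> triples n" and tE: "t \<in> E" and bl: "blockers n t \<inter> E = {}"
      and hc: "homologically_connected (hypergraph_complex n E)" for E
  proof (rule ccontr)
    assume "\<not> (Q \<inter> E = {} \<or> Q' \<inter> E = {})"
    then obtain y y' where y: "{u, x, y} \<in> E" "{v, x, y'} \<in> E"
      by (auto simp: Q_def Q'_def)
    have sh: "{u, x} \<in> shadow E" "{v, x} \<in> shadow E" "{u, v} \<in> shadow E"
      using y tE x t_eq by (auto simp: shadow_def intro: bexI[of _ "{u, x, y}"] bexI[of _ "{v, x, y'}"] bexI[of _ t])
    have G: "apex_edges t \<subseteq> shadow E" using tE by (auto simp: apex_edges_def shadow_def)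
    have even: "even (card {e\<in>apex_edges t. e \<subseteq> s})" if s: "s \<in> E" for s
    proof (cases "s = t")
      case True
      then have "{e\<in>apex_edges t. e \<subseteq> s} = apex_edges t" by (auto simp: apex_edges_def)
      moreover have "card (apex_edges t) = 2"
        by (rule card_apex_edges[OF t])
      ultimately show ?thesis by simp
    next
      case False
      then have "{e\<in>apex_edges t. e \<subseteq> s} = {}"
        using bl s E by (auto simp: blockers_def)
      then show ?thesis by (simp only: card.empty even_zero)
    qed
    obtain S where S: "\<And>e. e \<in> shadow E \<Longrightarrow> e \<in> apex_edges t \<longleftrightarrow> e \<in> vertex_cut S"
      using even_edge_set_is_cut[OF E hc G even] by metis
    have ne: "u \<noteq> x" "v \<noteq> x" using x t_eq by auto
    have "{u, x} \<notin> apex_edges t" "{v, x} \<notin> apex_edges t" "{u, v} \<in> apex_edges t"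
      using x t_eq by (auto simp: doubleton_eq_iff)
    then show False
      using S[OF sh(1)] S[OF sh(2)] S[OF sh(3)] t_eq(2) ne
      by (simp add: doubleton_in_cut_iff)
  qed
  then show ?thesis
    using sub card by (intro exI[of _ Q] exI[of _ Q'] conjI allI impI) simp_all
qed

section \<open>Below the threshold\<close>

abbreviation (input) hypergraph_prob :: "nat \<Rightarrow> real \<Rightarrow> (nat set set \<Rightarrow> bool) \<Rightarrow> real" where
  "hypergraph_prob n p P \<equiv> measure_pmf.prob (random_hypergraph n p) {E. P E}"

text \<open>Second moment for isolated vertices: a vertex lies in at most n^2 triples, two vertices
  in at most n common ones. This serves for \<open>p\<close> at most of order 1 / n^2, where the
  mean is of order n and the correlation factor tends to 1.\<close>

lemma isolated_vertex_bound:
  assumes p: "0 \<le> p" "p < 1" and n: "n \<ge> 2"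
  shows "hypergraph_prob n p (\<lambda>E. homologically_connected (hypergraph_complex n E))
    \<le> 4 * (1 / (real n * (1 - p) ^ (n * n)) + (1 / (1 - p) ^ n - 1))"
proof -
  let ?P = "measure_pmf.prob (random_hypergraph n p)"
  define N where "N = (\<lambda>v. {t\<in>triples n. v \<in> t})"
  define A where "A = (\<lambda>v. {E. {} \<subseteq> E \<and> N v \<inter> E = {}})"
  define \<mu> where "\<mu> = (\<Sum>v\<in>{1..n}. ?P (A v))"
  have N: "N v \<subseteq> triples n" for v by (auto simp: N_def)
  have cN: "card (N v) \<le> n * n" for v
  proof -
    have "N v \<subseteq> (\<lambda>(x, y). {v, x, y}) ` ({1..n} \<times> {1..n})"
    proof
      fix t assume "t \<in> N v"
      then have t: "t \<subseteq> {1..n}" "card t = 3" "v \<in> t" by (auto simp: N_def triples_def)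
      then have "card (t - {v}) = 2" by simp
      then obtain x y where xy: "t - {v} = {x, y}" by (auto simp: card_2_iff)
      have "t = insert v (t - {v})" using t by blast
      then have "t = {v, x, y}" unfolding xy .
      moreover from this have "x \<in> {1..n}" "y \<in> {1..n}" using t(1) by blast+
      ultimately show "t \<in> (\<lambda>(x, y). {v, x, y}) ` ({1..n} \<times> {1..n})" by blast
    qed
    then have "card (N v) \<le> card ((\<lambda>(x, y). {v, x, y}) ` ({1..n} \<times> {1..n}))"
      by (intro card_mono) auto
    also have "\<dots> \<le> card ({1..n} \<times> {1..n})" by (intro card_image_le) auto
    finally show ?thesis by (simp add: card_cartesian_product)
  qed
  have cNN: "card (N u \<inter> N v) \<le> n" if uv: "u \<noteq> v" for u v
  proof -
    have "N u \<inter> N v \<subseteq> (\<lambda>x. insert x {u, v}) ` {1..n}"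
    proof
      fix t assume "t \<in> N u \<inter> N v"
      then have "t \<in> triples n" "{u, v} \<subseteq> t" by (auto simp: N_def)
      then obtain x where "x \<in> {1..n}" "t = insert x {u, v}"
        using triple_insert[of t n "{u, v}"] uv by auto
      then show "t \<in> (\<lambda>x. insert x {u, v}) ` {1..n}" by blast
    qed
    then have "card (N u \<inter> N v) \<le> card ((\<lambda>x. insert x {u, v}) ` {1..n})"
      by (intro card_mono) auto
    also have "\<dots> \<le> card {1..n}" by (intro card_image_le) auto
    finally show ?thesis by simp
  qed
  have PA: "?P (A v) = (1 - p) ^ card (N v)" for v
    unfolding A_def using prob_random_hypergraph[of p "{}" n "N v"] p N by simp
  have "real n * (1 - p) ^ (n * n) = (\<Sum>v\<in>{1..n}. (1 - p) ^ (n * n))" by simp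
  also have "\<dots> \<le> \<mu>"
    unfolding \<mu>_def PA using p cN by (intro sum_mono power_decreasing) auto
  finally have mu: "real n * (1 - p) ^ (n * n) \<le> \<mu>" .
  have pos: "real n * (1 - p) ^ (n * n) > 0" using p n by simp
  have "hypergraph_prob n p (\<lambda>E. homologically_connected (hypergraph_complex n E))
      \<le> hypergraph_prob n p (\<lambda>E. real (card {v\<in>{1..n}. E \<in> A v}) \<le> \<mu> / 2)"
  proof (rule prob_random_hypergraph_mono)
    fix E assume "E \<subseteq> triples n" "homologically_connected (hypergraph_complex n E)"
    then have "{v\<in>{1..n}. E \<in> A v} = {}"
      using isolated_vertex_not_connected[of E n] n by (auto simp: A_def N_def)
    then show "real (card {v\<in>{1..n}. E \<in> A v}) \<le> \<mu> / 2"
      using mu pos by (simp only: card.empty)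
  qed
  also have "\<dots> \<le> 4 * (1 / \<mu> + (1 / (1 - p) ^ n - 1))"
    unfolding \<mu>_def
  proof (rule second_moment_card_events)
    show "(\<Sum>v\<in>{1..n}. ?P (A v)) > 0" using mu pos by (simp add: \<mu>_def)
    show "?P (A u \<inter> A v) \<le> 1 / (1 - p) ^ n * (?P (A u) * ?P (A v))" if "u \<noteq> v" for u v
      unfolding A_def by (rule prob_random_hypergraph_corr) (use p N cNN[OF that] in auto)
  qed (use p in auto)
  also have "1 / \<mu> \<le> 1 / (real n * (1 - p) ^ (n * n))"
    using mu pos by (intro frac_le) linarith+
  finally show ?thesis by simp
qed

definition pendant_event :: "nat \<Rightarrow> nat set \<Rightarrow> nat set set set" where
  "pendant_event n t = {E. {t} \<subseteq> E \<and> blockers n t \<inter> E = {}}"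

lemma prob_pendant_event:
  assumes "0 \<le> p" "p \<le> 1" "t \<in> triples n"
  shows "measure_pmf.prob (random_hypergraph n p) (pendant_event n t) = p * (1 - p) ^ card (blockers n t)"
  unfolding pendant_event_def
  by (subst prob_random_hypergraph) (use assms in \<open>auto simp: blockers_def\<close>)

lemma pendant_expectation_ge:
  assumes "0 \<le> p" "p \<le> 1" "n \<ge> 3"
  shows "(real n / 3) ^ 3 * (p * (1 - p) ^ (2 * n))
    \<le> (\<Sum>t\<in>triples n. measure_pmf.prob (random_hypergraph n p) (pendant_event n t))"
proof -
  have "card (triples n) = n choose 3"
    unfolding triples_def using n_subsets[of "{1..n}" 3] by simp
  moreover have "(real n / 3) ^ 3 \<le> real (n choose 3)"
    using binomial_ge_n_over_k_pow_k[of 3 n, where 'a = real] assms(3) by simp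
  ultimately have "(real n / 3) ^ 3 * (p * (1 - p) ^ (2 * n)) \<le> (\<Sum>t\<in>triples n. p * (1 - p) ^ (2 * n))"
    using assms by (simp add: mult_right_mono)
  also have "\<dots> \<le> (\<Sum>t\<in>triples n. measure_pmf.prob (random_hypergraph n p) (pendant_event n t))"
  proof (rule sum_mono)
    fix t assume t: "t \<in> triples n"
    show "p * (1 - p) ^ (2 * n) \<le> measure_pmf.prob (random_hypergraph n p) (pendant_event n t)"
      unfolding prob_pendant_event[OF assms(1,2) t]
      using assms card_blockers_le[OF t] by (intro mult_left_mono power_decreasing) auto
  qed
  finally show ?thesis .
qed

text \<open>Triples sharing an apex edge block each other, so their events exclude one another; all
  other pairs have at most four common blockers.\<close>

lemma pendant_concentration:
  fixes n :: nat and p :: real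
  defines "\<mu> \<equiv> \<Sum>t\<in>triples n. measure_pmf.prob (random_hypergraph n p) (pendant_event n t)"
  assumes p: "0 \<le> p" "p < 1" and mu: "0 < m" "m \<le> \<mu>"
  shows "hypergraph_prob n p (\<lambda>E. real (card {t\<in>triples n. E \<in> pendant_event n t}) \<le> \<mu> / 2)
    \<le> 4 * (1 / m + (1 / (1 - p) ^ 4 - 1))"
proof -
  let ?P = "measure_pmf.prob (random_hypergraph n p)"
  have "hypergraph_prob n p (\<lambda>E. real (card {t\<in>triples n. E \<in> pendant_event n t}) \<le> \<mu> / 2)
    \<le> 4 * (1 / \<mu> + (1 / (1 - p) ^ 4 - 1))"
    unfolding \<mu>_def
  proof (rule second_moment_card_events)
    show "(\<Sum>t\<in>triples n. ?P (pendant_event n t)) > 0" using mu by (simp add: \<mu>_def)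
    fix s t assume st: "s \<in> triples n" "t \<in> triples n" "s \<noteq> t"
    show "?P (pendant_event n s \<inter> pendant_event n t) \<le>
        1 / (1 - p) ^ 4 * (?P (pendant_event n s) * ?P (pendant_event n t))"
    proof (cases "apex_edges s \<inter> apex_edges t = {}")
      case True
      show ?thesis
        unfolding pendant_event_def
        by (rule prob_random_hypergraph_corr)
           (use p st card_blockers_Int_le[OF st(1,2) True] in \<open>auto simp: blockers_def\<close>)
    next
      case False
      then have "s \<in> blockers n t"
        using st by (auto simp: blockers_def apex_edges_def)
      then have "pendant_event n s \<inter> pendant_event n t = {}"
        by (auto simp: pendant_event_def)
      then show ?thesis using p by simp
    qed
  qed (use p in auto)
  also have "1 / \<mu> \<le> 1 / m"
    using mu by (intro divide_left_mono mult_pos_pos) auto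
  finally show ?thesis by simp
qed

text \<open>Connectedness allows at most n pendant triples, but half of their expected number
  already exceeds n.\<close>

lemma many_pendants_bound:
  assumes p: "0 \<le> p" "p < 1" and n: "n \<ge> 3"
    and m: "m = (real n / 3) ^ 3 * (p * (1 - p) ^ (2 * n))" "m > 2 * real n"
  shows "hypergraph_prob n p (\<lambda>E. homologically_connected (hypergraph_complex n E))
    \<le> 4 * (1 / m + (1 / (1 - p) ^ 4 - 1))"
proof -
  define \<mu> where "\<mu> = (\<Sum>t\<in>triples n. measure_pmf.prob (random_hypergraph n p) (pendant_event n t))"
  have mu: "m \<le> \<mu>" unfolding m \<mu>_def by (rule pendant_expectation_ge) (use p n in auto)
  have m0: "m > 0" using m(2) by (meson of_nat_0_le_iff le_less_trans mult_nonneg_nonneg zero_le_numeral)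
  have "hypergraph_prob n p (\<lambda>E. homologically_connected (hypergraph_complex n E))
    \<le> hypergraph_prob n p (\<lambda>E. real (card {t\<in>triples n. E \<in> pendant_event n t}) \<le> \<mu> / 2)"
  proof (rule prob_random_hypergraph_mono)
    fix E assume "E \<subseteq> triples n" "homologically_connected (hypergraph_complex n E)"
    then have "card {t\<in>triples n. E \<in> pendant_event n t} \<le> n"
      using pendant_triples_le[of E n] by (simp add: pendant_event_def)
    then show "real (card {t\<in>triples n. E \<in> pendant_event n t}) \<le> \<mu> / 2"
      using mu m(2) by linarith
  qed
  also have "\<dots> \<le> 4 * (1 / m + (1 / (1 - p) ^ 4 - 1))"
    unfolding \<mu>_def by (rule pendant_concentration) (use p m0 mu in \<open>auto simp: \<mu>_def\<close>)
  finally show ?thesis .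
qed

text \<open>If the complex is connected, every pendant triple is bad: one of its families
  \<open>Q\<close>, \<open>Q'\<close> is missed. The expected number of bad ones is at most 2 (1 -
  p) ^ (n - 4) \<mu>, so by Markov's inequality they rarely reach \<mu> / 2, which the number of
  pendant triples typically exceeds. In contrast to the comparison with n, a mean tending to
  infinity is enough here.\<close>

lemma good_pendant_bound:
  assumes p: "0 \<le> p" "p < 1" and n: "n \<ge> 4"
    and m: "m = (real n / 3) ^ 3 * (p * (1 - p) ^ (2 * n))" "m > 0"
  shows "hypergraph_prob n p (\<lambda>E. homologically_connected (hypergraph_complex n E))
    \<le> 4 * (1 / m + (1 / (1 - p) ^ 4 - 1)) + 4 * (1 - p) ^ (n - 4)"
proof -
  let ?P = "measure_pmf.prob (random_hypergraph n p)"
  define \<mu> where "\<mu> = (\<Sum>t\<in>triples n. ?P (pendant_event n t))"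
  have mu: "m \<le> \<mu>" unfolding m \<mu>_def by (rule pendant_expectation_ge) (use p n in auto)
  define \<Phi> where "\<Phi> = (\<lambda>t Q Q'. Q \<subseteq> triples n - insert t (blockers n t) \<and> Q' \<subseteq> triples n - insert t (blockers n t) \<and>
    n - 4 \<le> card Q \<and> n - 4 \<le> card Q' \<and>
    (\<forall>E. E \<subseteq> triples n \<longrightarrow> t \<in> E \<longrightarrow> blockers n t \<inter> E = {} \<longrightarrow>
      homologically_connected (hypergraph_complex n E) \<longrightarrow> Q \<inter> E = {} \<or> Q' \<inter> E = {}))"
  have "\<exists>Q Q'. \<Phi> t Q Q'" if "t \<in> triples n" for t
    unfolding \<Phi>_def by (rule pendant_triple_witnesses[OF that n])
  then obtain Q Q' where \<Phi>: "\<And>t. t \<in> triples n \<Longrightarrow> \<Phi> t (Q t) (Q' t)"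
    by metis
  have Q: "\<And>t. t \<in> triples n \<Longrightarrow> Q t \<subseteq> triples n - insert t (blockers n t)"
      "\<And>t. t \<in> triples n \<Longrightarrow> Q' t \<subseteq> triples n - insert t (blockers n t)"
      "\<And>t. t \<in> triples n \<Longrightarrow> n - 4 \<le> card (Q t)" "\<And>t. t \<in> triples n \<Longrightarrow> n - 4 \<le> card (Q' t)"
    and Q_hit: "\<And>t E. \<lbrakk>t \<in> triples n; E \<subseteq> triples n; t \<in> E; blockers n t \<inter> E = {};
      homologically_connected (hypergraph_complex n E)\<rbrakk> \<Longrightarrow> Q t \<inter> E = {} \<or> Q' t \<inter> E = {}"
    using \<Phi> unfolding \<Phi>_def by simp_all
  define B where "B = (\<lambda>t. pendant_event n t \<inter> {E. Q t \<inter> E = {} \<or> Q' t \<inter> E = {}})"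
  have avoid: "?P {E. {t} \<subseteq> E \<and> (blockers n t \<union> R) \<inter> E = {}} \<le> ?P (pendant_event n t) * (1 - p) ^ (n - 4)"
    if t: "t \<in> triples n" and R: "R \<subseteq> triples n - insert t (blockers n t)" "n - 4 \<le> card R" for t R
  proof -
    have fR: "finite R" by (rule finite_subset[OF _ finite_triples]) (use R in blast)
    have fB: "finite (blockers n t)" by (simp add: blockers_def)
    have "?P {E. {t} \<subseteq> E \<and> (blockers n t \<union> R) \<inter> E = {}} = p ^ card {t} * (1 - p) ^ card (blockers n t \<union> R)"
      by (rule prob_random_hypergraph) (use p t R in \<open>auto simp: blockers_def\<close>)
    also have "card (blockers n t \<union> R) = card (blockers n t) + card R"
      using R fR fB by (intro card_Un_disjoint) auto
    also have "p ^ card {t} * (1 - p) ^ (card (blockers n t) + card R) = ?P (pendant_event n t) * (1 - p) ^ card R"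
      using p t by (simp add: prob_pendant_event power_add)
    also have "\<dots> \<le> ?P (pendant_event n t) * (1 - p) ^ (n - 4)"
      using p R by (intro mult_left_mono power_decreasing) auto
    finally show ?thesis .
  qed
  have PB: "?P (B t) \<le> 2 * (?P (pendant_event n t) * (1 - p) ^ (n - 4))" if t: "t \<in> triples n" for t
  proof -
    have B_eq: "B t = {E. ({t} \<subseteq> E \<and> (blockers n t \<union> Q t) \<inter> E = {}) \<or> ({t} \<subseteq> E \<and> (blockers n t \<union> Q' t) \<inter> E = {})}"
      by (auto simp: B_def pendant_event_def)
    show ?thesis
      unfolding B_eq using prob_pmf_union_le[of "random_hypergraph n p" "\<lambda>E. {t} \<subseteq> E \<and> (blockers n t \<union> Q t) \<inter> E = {}"
          "\<lambda>E. {t} \<subseteq> E \<and> (blockers n t \<union> Q' t) \<inter> E = {}"]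
        avoid[OF t Q(1)[OF t] Q(3)[OF t]] avoid[OF t Q(2)[OF t] Q(4)[OF t]] by linarith
  qed
  have "hypergraph_prob n p (\<lambda>E. homologically_connected (hypergraph_complex n E))
    \<le> hypergraph_prob n p (\<lambda>E. real (card {t\<in>triples n. E \<in> pendant_event n t}) \<le> \<mu> / 2 \<or>
        \<mu> / 2 \<le> real (card {t\<in>triples n. E \<in> B t}))"
  proof (rule prob_random_hypergraph_mono)
    fix E assume "E \<subseteq> triples n" "homologically_connected (hypergraph_complex n E)"
    then have "{t\<in>triples n. E \<in> pendant_event n t} = {t\<in>triples n. E \<in> B t}"
      using Q_hit by (auto simp: B_def pendant_event_def)
    then show "real (card {t\<in>triples n. E \<in> pendant_event n t}) \<le> \<mu> / 2 \<or>
        \<mu> / 2 \<le> real (card {t\<in>triples n. E \<in> B t})"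
      by auto
  qed
  also have "\<dots> \<le> hypergraph_prob n p (\<lambda>E. real (card {t\<in>triples n. E \<in> pendant_event n t}) \<le> \<mu> / 2) +
      hypergraph_prob n p (\<lambda>E. \<mu> / 2 \<le> real (card {t\<in>triples n. E \<in> B t}))"
    by (rule prob_pmf_union_le)
  also have "hypergraph_prob n p (\<lambda>E. real (card {t\<in>triples n. E \<in> pendant_event n t}) \<le> \<mu> / 2)
      \<le> 4 * (1 / m + (1 / (1 - p) ^ 4 - 1))"
    unfolding \<mu>_def by (rule pendant_concentration) (use p m mu in \<open>auto simp: \<mu>_def\<close>)
  also have "hypergraph_prob n p (\<lambda>E. \<mu> / 2 \<le> real (card {t\<in>triples n. E \<in> B t}))
      \<le> (\<Sum>t\<in>triples n. ?P (B t)) / (\<mu> / 2)"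
    by (rule markov_card_events) (use m mu in auto)
  also have "\<dots> \<le> (2 * (1 - p) ^ (n - 4) * \<mu>) / (\<mu> / 2)"
  proof (rule divide_right_mono)
    have "(\<Sum>t\<in>triples n. ?P (B t)) \<le> (\<Sum>t\<in>triples n. 2 * (?P (pendant_event n t) * (1 - p) ^ (n - 4)))"
      by (intro sum_mono PB)
    also have "\<dots> = 2 * (1 - p) ^ (n - 4) * \<mu>"
      by (simp add: \<mu>_def sum_distrib_left mult_ac)
    finally show "(\<Sum>t\<in>triples n. ?P (B t)) \<le> 2 * (1 - p) ^ (n - 4) * \<mu>" .
  qed (use m mu in simp)
  also have "\<dots> = 4 * (1 - p) ^ (n - 4)"
    using m mu by simp
  finally show ?thesis by simp
qed

section \<open>Estimates for all densities below the threshold\<close>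

lemma exp_le_one_minus_power:
  fixes p :: real
  assumes "0 \<le> p" "p \<le> 1/2"
  shows "exp (- (real k * (p + 2 * p\<^sup>2))) \<le> (1 - p) ^ k"
proof -
  have "- p - 2 * p\<^sup>2 \<le> ln (1 - p)"
    using ln_one_minus_pos_lower_bound[of p] assms by simp
  then have "exp (- p - 2 * p\<^sup>2) \<le> 1 - p"
    using assms by (subst ln_ge_iff[symmetric]) auto
  then have "exp (- p - 2 * p\<^sup>2) ^ k \<le> (1 - p) ^ k"
    by (intro power_mono) auto
  then show ?thesis
    by (simp add: exp_of_nat_mult[symmetric] algebra_simps)
qed

lemma one_minus_power_le_exp:
  fixes p :: real
  assumes "p \<le> 1"
  shows "(1 - p) ^ k \<le> exp (- (real k * p))"
proof -
  have "(1 - p) ^ k \<le> exp (- p) ^ k"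
    using exp_ge_add_one_self[of "- p"] assms by (intro power_mono) auto
  then show ?thesis
    by (simp add: exp_of_nat_mult[symmetric])
qed

text \<open>Below this multiple of \<open>1 / n\<^sup>2\<close> isolated vertices are used, above it pendant triples.\<close>

definition low_density :: real where
  "low_density = 54 * exp 6 + 1"

text \<open>The errors of all density ranges are added, so that one bound serves every
  \<open>n\<close>, whichever range \<open>p\<close> falls into. Near the threshold the third term
  bounds the inverse mean of the pendant triples, the fourth their correlation and the fifth the bad
  ones.\<close>

definition subcritical_error :: "(nat \<Rightarrow> real) \<Rightarrow> nat \<Rightarrow> real" where
  "subcritical_error \<omega> n =
     4 * (exp (2 * low_density) / real n + (1 / (1 - low_density / real n) - 1)) +
     4 * (1 / (2 * real n)) + 432 * exp 4 * exp (- (2 * \<omega> n)) +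
     4 * (1 / (1 - 8 * ln (real n) / real n) - 1) + 4 * exp 2 * exp (- (ln (real n) / 4))"

lemma subcritical_error_tendsto:
  assumes "filterlim \<omega> at_top sequentially"
  shows "subcritical_error \<omega> \<longlonglongrightarrow> 0"
proof -
  have 1: "(\<lambda>n. 4 * (exp (2 * low_density) / real n + (1 / (1 - low_density / real n) - 1)) +
     4 * (1 / (2 * real n))) \<longlonglongrightarrow> 0"
    by real_asymp
  have 2: "(\<lambda>n. 4 * (1 / (1 - 8 * ln (real n) / real n) - 1) + 4 * exp 2 * exp (- (ln (real n) / 4))) \<longlonglongrightarrow> 0"
    by real_asymp
  have "((\<lambda>x::real. 432 * exp 4 * exp (- (2 * x))) \<longlongrightarrow> 0) at_top"
    by real_asymp
  then have 3: "(\<lambda>n. 432 * exp 4 * exp (- (2 * \<omega> n))) \<longlonglongrightarrow> 0"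
    using assms by (rule filterlim_compose)
  show ?thesis
    unfolding subcritical_error_def using tendsto_add[OF tendsto_add[OF 1 3] 2] by (simp add: add_ac)
qed

text \<open>The mean number of pendant triples is at least of order n^2 c exp (- 2 c) with c = n p.
  For c \<le> log n / 4, but not too small, this exceeds 2 n. For larger c it is at least of order
  exp (2 \<omega>), and (1 - p) ^ (n - 4) is at most of order n ^ (- 1 / 4), so few pendant triples
  are bad.\<close>

lemma subcritical_bound:
  fixes n :: nat and p :: real and \<omega> :: "nat \<Rightarrow> real"
  defines "L \<equiv> ln (real n)"
  assumes p: "0 \<le> p" and p_eq: "p = (L + 1/2 * ln L - \<omega> n) / real n"
    and n: "n \<ge> 4" "real n > low_density" "L \<ge> 1" "8 * L < real n" "(2 * L)\<^sup>2 \<le> real n"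
      "2 * real n < real n * exp (L / 2) * exp (- 4) / 27"
    and \<omega>: "\<omega> n \<ge> 0"
  shows "hypergraph_prob n p (\<lambda>E. homologically_connected (hypergraph_complex n E)) \<le> subcritical_error \<omega> n"
proof -
  let ?P = "hypergraph_prob n p (\<lambda>E. homologically_connected (hypergraph_complex n E))"
  define c where "c = real n * p"
  have n0: "real n > 0" using n by simp
  have c_eq: "c = L + 1/2 * ln L - \<omega> n" using n0 by (simp add: c_def p_eq)
  have "ln L \<le> L" using n(3) ln_le_minus_one[of L] by simp
  then have c2: "c \<le> 2 * L" using \<omega> n(3) by (simp add: c_eq)
  have c0: "c \<ge> 0" using p by (simp add: c_def)
  have p_c: "p = c / real n" using n0 by (simp add: c_def)
  have p_le: "p \<le> 2 * L / real n" using c2 n0 by (simp add: p_c divide_right_mono)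
  have "2 * L / real n \<le> 1/4" using n(4) n0 by (simp add: field_simps)
  then have p4: "p \<le> 1/4" using p_le by linarith
  have K0: "low_density > 1" by (simp add: low_density_def)
  have np2: "real n * p\<^sup>2 \<le> 1"
  proof -
    have "real n * p\<^sup>2 = c\<^sup>2 / real n" using n0 by (simp add: p_c power2_eq_square)
    also have "\<dots> \<le> (2 * L)\<^sup>2 / real n" using c2 c0 by (intro divide_right_mono power_mono) auto
    also have "\<dots> \<le> 1" using n(5) n0 by simp
    finally show ?thesis .
  qed
  have pow4: "1 / (1 - p) ^ 4 - 1 \<le> 1 / (1 - 8 * L / real n) - 1"
  proof -
    have "8 * L / real n = 4 * (2 * L / real n)" by simp
    then have "1 - 8 * L / real n \<le> 1 - 4 * p" using p_le by linarith
    also have "\<dots> \<le> (1 - p) ^ 4" using Bernoulli_inequality[of "- p" 4] p4 by simp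
    finally have "1 - 8 * L / real n \<le> (1 - p) ^ 4" .
    moreover have "1 - 8 * L / real n > 0" using n(4) n0 by simp
    ultimately show ?thesis using p4 by (simp add: frac_le)
  qed
  have K_nonneg: "1 / (1 - low_density / real n) - 1 \<ge> 0"
    using n(2) K0 n0 by (simp add: field_simps)
  have L_nonneg: "1 / (1 - 8 * L / real n) - 1 \<ge> 0"
    using n(3,4) n0 by (simp add: field_simps)
  define e1 where "e1 = 4 * (exp (2 * low_density) / real n + (1 / (1 - low_density / real n) - 1))"
  define e2 where "e2 = 4 * (1 / (2 * real n))"
  define e3 where "e3 = 432 * exp 4 * exp (- (2 * \<omega> n))"
  define e4 where "e4 = 4 * (1 / (1 - 8 * L / real n) - 1)"
  define e5 where "e5 = 4 * exp 2 * exp (- (L / 4))"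
  have nonneg: "e1 \<ge> 0" "e2 \<ge> 0" "e3 \<ge> 0" "e4 \<ge> 0" "e5 \<ge> 0"
    using K_nonneg L_nonneg by (auto simp: e1_def e2_def e3_def e4_def e5_def)
  have err: "subcritical_error \<omega> n = e1 + e2 + e3 + e4 + e5"
    by (simp add: subcritical_error_def e1_def e2_def e3_def e4_def e5_def L_def)
  define m where "m = (real n / 3) ^ 3 * (p * (1 - p) ^ (2 * n))"
  \<comment> \<open>The factor exp (- 4) absorbs the second order error 4 n p^2 in the exponent, as
    n p^2 \<le> 1.\<close>
  have m_ge: "(real n)\<^sup>2 / 27 * c * exp (- (2 * c)) * exp (- 4) \<le> m"
  proof -
    have "exp (- (2 * c)) * exp (- 4) \<le> exp (- (real (2 * n) * (p + 2 * p\<^sup>2)))"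
      using np2 by (simp add: exp_add[symmetric] c_def algebra_simps)
    also have "\<dots> \<le> (1 - p) ^ (2 * n)"
      by (rule exp_le_one_minus_power) (use p p4 in auto)
    finally have *: "exp (- (2 * c)) * exp (- 4) \<le> (1 - p) ^ (2 * n)" .
    have "(real n)\<^sup>2 / 27 * c * exp (- (2 * c)) * exp (- 4) =
        (real n / 3) ^ 3 * (p * (exp (- (2 * c)) * exp (- 4)))"
      by (simp add: c_def power2_eq_square power3_eq_cube)
    also have "\<dots> \<le> m"
      unfolding m_def using * p by (intro mult_left_mono) auto
    finally show ?thesis .
  qed
  consider (low) "c \<le> low_density / real n" | (mid) "low_density / real n < c" "c \<le> L / 4" | (high) "L / 4 < c"
    by linarith
  then show ?thesis
  proof cases
    case low
    have pn2: "p * real (n * n) \<le> low_density"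
      using low n0 by (simp add: c_def field_simps)
    have "exp (- (2 * low_density)) \<le> exp (- (real (n * n) * (p + 2 * p\<^sup>2)))"
    proof -
      have "p * p \<le> p * (1/4)" using p p4 by (intro mult_left_mono)
      then have "2 * p\<^sup>2 \<le> p" using p by (simp add: power2_eq_square)
      then have "real (n * n) * (p + 2 * p\<^sup>2) \<le> real (n * n) * (2 * p)"
        by (intro mult_left_mono) auto
      then show ?thesis using pn2 by (simp add: mult_ac)
    qed
    also have "\<dots> \<le> (1 - p) ^ (n * n)"
      by (rule exp_le_one_minus_power) (use p p4 in auto)
    finally have "real n * exp (- (2 * low_density)) \<le> real n * (1 - p) ^ (n * n)"
      using n0 by simp
    then have "1 / (real n * (1 - p) ^ (n * n)) \<le> 1 / (real n * exp (- (2 * low_density)))"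
      using n0 p4 by (intro divide_left_mono mult_pos_pos) auto
    then have a: "1 / (real n * (1 - p) ^ (n * n)) \<le> exp (2 * low_density) / real n"
      by (simp add: exp_minus field_simps)
    have "1 - low_density / real n \<le> 1 - real n * p" using low by (simp add: c_def)
    also have "\<dots> \<le> (1 - p) ^ n" using Bernoulli_inequality[of "- p" n] p4 by simp
    finally have "1 / (1 - p) ^ n \<le> 1 / (1 - low_density / real n)"
      using n(2) n0 by (intro frac_le) auto
    with a have "4 * (1 / (real n * (1 - p) ^ (n * n)) + (1 / (1 - p) ^ n - 1)) \<le> e1"
      by (simp add: e1_def)
    moreover have "?P \<le> 4 * (1 / (real n * (1 - p) ^ (n * n)) + (1 / (1 - p) ^ n - 1))"
      by (rule isolated_vertex_bound) (use p p4 n in auto)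
    ultimately show ?thesis using nonneg err by linarith
  next
    case mid
    have m2: "2 * real n < m"
    \<comment> \<open>The function c exp (- 2 c) is not monotone: up to 1 the factor c is bounded
      below by the left end of the range, beyond 1 the exponential by its right end.\<close>
    proof (cases "c \<le> 1")
      case True
      have "2 * real n < (real n)\<^sup>2 / 27 * (low_density / real n) * exp (- 2) * exp (- 4)"
      proof -
        \<comment> \<open>Origin of \<open>low_density\<close>: it has to exceed 2 * 27 * exp
          6.\<close>
        have "exp (- 2) * exp (- 4) = (1 / exp 6 :: real)"
          by (simp add: exp_minus field_simps exp_add[symmetric])
        then have "(real n)\<^sup>2 / 27 * (low_density / real n) * exp (- 2) * exp (- 4) =
            real n * (54 * exp 6 + 1) / (27 * exp 6)"
          using n0 by (simp add: low_density_def power2_eq_square mult.assoc)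
        also have "\<dots> > 2 * real n" using n0 by (simp add: field_simps)
        finally show ?thesis .
      qed
      also have "\<dots> \<le> (real n)\<^sup>2 / 27 * c * exp (- (2 * c)) * exp (- 4)"
        using mid True K0 n0 c0 by (intro mult_right_mono mult_mono) auto
      also note m_ge
      finally show ?thesis .
    next
      case False
      have "2 * real n < real n * exp (L / 2) * exp (- 4) / 27" by (rule n(6))
      also have "\<dots> = (real n)\<^sup>2 / 27 * 1 * exp (- (2 * (L / 4))) * exp (- 4)"
      proof -
        have "exp (L / 2) = exp L * exp (- (L / 2))" by (simp add: exp_add[symmetric])
        then have "exp (L / 2) = real n * exp (- (L / 2))" using n0 by (simp add: L_def)
        then show ?thesis by (simp add: power2_eq_square)
      qed
      also have "\<dots> \<le> (real n)\<^sup>2 / 27 * c * exp (- (2 * c)) * exp (- 4)"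
        using mid False by (intro mult_right_mono mult_mono) auto
      also note m_ge
      finally show ?thesis .
    qed
    have "?P \<le> 4 * (1 / m + (1 / (1 - p) ^ 4 - 1))"
      by (rule many_pendants_bound) (use p p4 n m2 m_def in auto)
    moreover have "1 / m \<le> 1 / (2 * real n)"
      using m2 n0 by (intro divide_left_mono mult_pos_pos) auto
    ultimately show ?thesis using nonneg err pow4 by (simp add: e2_def e4_def)
  next
    case high
    have m3: "exp (2 * \<omega> n) / (108 * exp 4) \<le> m"
    proof -
      \<comment> \<open>Here log log n / 2 enters: exp (- 2 c) carries a factor 1 / L, which c > L /
        4 compensates.\<close>
      have "exp (- (2 * c)) = exp (2 * \<omega> n) / ((real n)\<^sup>2 * L)"
      proof -
        have eq: "- (2 * c) = 2 * \<omega> n - (L + L + ln L)" by (simp add: c_eq algebra_simps)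
        have "exp (- (2 * c)) = exp (2 * \<omega> n) / (exp L * exp L * exp (ln L))"
          by (simp only: eq exp_diff exp_add)
        then show ?thesis using n(1,3) n0 by (simp add: L_def power2_eq_square)
      qed
      then have "exp (2 * \<omega> n) / (108 * exp 4) = (real n)\<^sup>2 / 27 * (L / 4) * exp (- (2 * c)) * exp (- 4)"
        using n0 n(3) by (simp add: exp_minus field_simps)
      also have "\<dots> \<le> (real n)\<^sup>2 / 27 * c * exp (- (2 * c)) * exp (- 4)"
        using high by (intro mult_right_mono mult_left_mono) auto
      also note m_ge
      finally show ?thesis .
    qed
    have m0: "exp (2 * \<omega> n) / (108 * exp 4) > 0" by simp
    have "?P \<le> 4 * (1 / m + (1 / (1 - p) ^ 4 - 1)) + 4 * (1 - p) ^ (n - 4)"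
      by (rule good_pendant_bound[OF p _ n(1) m_def]) (use p4 m3 m0 in linarith)+
    moreover have "4 * (1 / m) \<le> e3"
    proof -
      have "1 / m \<le> 1 / (exp (2 * \<omega> n) / (108 * exp 4))"
        using m3 m0 by (intro divide_left_mono mult_pos_pos) linarith+
      then show ?thesis by (simp add: e3_def exp_minus field_simps)
    qed
    moreover have "4 * (1 - p) ^ (n - 4) \<le> e5"
    proof -
      have "(1 - p) ^ (n - 4) \<le> exp (- (real (n - 4) * p))"
        using p4 by (intro one_minus_power_le_exp) auto
      \<comment> \<open>The four vertices left out change the exponent by 4 p \<le> 1, which the
        summand 2 covers.\<close>
      also have "\<dots> \<le> exp (2 - L / 4)"
        using high p4 p n(1) by (simp add: of_nat_diff c_def algebra_simps)
      also have "\<dots> = exp 2 * exp (- (L / 4))" by (simp add: exp_add[symmetric])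
      finally show ?thesis by (simp add: e5_def)
    qed
    ultimately show ?thesis using nonneg err pow4 by (simp add: e4_def)
  qed
qed

lemma subcritical_not_connected:
  fixes \<omega> p :: "nat \<Rightarrow> real"
  assumes \<omega>: "filterlim \<omega> at_top sequentially" and p: "\<And>n. 0 \<le> p n"
    and p_eq: "\<forall>\<^sub>F n in sequentially. p n = (ln (real n) + 1 / 2 * ln (ln (real n)) - \<omega> n) / real n"
  shows "(\<lambda>n. hypergraph_prob n (p n) (\<lambda>E. homologically_connected (hypergraph_complex n E))) \<longlonglongrightarrow> 0"
proof (rule tendsto_sandwich[OF _ _ tendsto_const subcritical_error_tendsto[OF \<omega>]])
  have "\<forall>\<^sub>F n in sequentially. \<omega> n \<ge> 0"
    using \<omega> by (simp add: filterlim_at_top)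
  moreover have "\<forall>\<^sub>F n in sequentially. n \<ge> 4 \<and> real n > low_density \<and> ln (real n) \<ge> 1 \<and>
      8 * ln (real n) < real n \<and> (2 * ln (real n))\<^sup>2 \<le> real n \<and>
      2 * real n < real n * exp (ln (real n) / 2) * exp (- 4) / 27"
    by (intro eventually_conj eventually_ge_at_top; real_asymp)
  ultimately show "\<forall>\<^sub>F n in sequentially.
      hypergraph_prob n (p n) (\<lambda>E. homologically_connected (hypergraph_complex n E)) \<le> subcritical_error \<omega> n"
    using p_eq
  proof eventually_elim
    case (elim n)
    then show ?case
      using p[of n] by (intro subcritical_bound) auto
  qed
qed simp

section \<open>Odd triples and minimal cocycles\<close>

lemma card_3_obtain:
  assumes "card t = 3"
  obtains x y z where "t = {x, y, z}" "x \<noteq> y" "x \<noteq> z" "y \<noteq> z"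
  using assms unfolding card_3_iff by blast

lemma card_edges_in_triple:
  assumes G: "\<forall>e\<in>G. card e = 2" and d: "x \<noteq> y" "x \<noteq> z" "y \<noteq> z"
  shows "card {e\<in>G. e \<subseteq> {x, y, z}} =
    of_bool ({x, y} \<in> G) + of_bool ({x, z} \<in> G) + of_bool ({y, z} \<in> G)"
proof -
  have "e = {x, y} \<or> e = {x, z} \<or> e = {y, z}" if e: "e \<subseteq> {x, y, z}" "card e = 2" for e
  proof -
    obtain a b where "e = {a, b}" "a \<noteq> b" using e(2) by (auto simp: card_2_iff)
    then show ?thesis using e(1) by auto
  qed
  then have "{e\<in>G. e \<subseteq> {x, y, z}} = {e\<in>{{x, y}, {x, z}, {y, z}}. e \<in> G}"
    using G by blast
  also have "\<dots> = (if {x, y} \<in> G then {{x, y}} else {}) \<union>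
      ((if {x, z} \<in> G then {{x, z}} else {}) \<union> (if {y, z} \<in> G then {{y, z}} else {}))"
    by auto
  also have "card \<dots> = of_bool ({x, y} \<in> G) + of_bool ({x, z} \<in> G) + of_bool ({y, z} \<in> G)"
    using d by (simp add: card_insert_if doubleton_eq_iff)
  finally show ?thesis .
qed

text \<open>The triples on which the indicator of \<open>G\<close> has nonzero coboundary, whether
  or not they are faces; for a cocycle none of them is a face.\<close>

definition odd_triples :: "nat \<Rightarrow> nat set set \<Rightarrow> nat set set" where
  "odd_triples n G = {t\<in>triples n. odd (card {e\<in>G. e \<subseteq> t})}"

definition edge_pairs :: "nat \<Rightarrow> nat set set" where
  "edge_pairs n = {e. e \<subseteq> {1..n} \<and> card e = 2}"

lemma finite_edge_pairs [simp]: "finite (edge_pairs n)"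
  by (rule finite_subset[of _ "Pow {1..n}"]) (auto simp: edge_pairs_def)

lemma card_edge_pairs_le: "card (edge_pairs n) \<le> n\<^sup>2"
proof -
  have "card (edge_pairs n) = n choose 2"
    unfolding edge_pairs_def using n_subsets[of "{1..n}" 2] by simp
  also have "\<dots> \<le> n\<^sup>2"
    by (cases "2 \<le> n") (auto intro: binomial_le_pow simp: binomial_eq_0)
  finally show ?thesis .
qed

lemma shadow_subset_edge_pairs: "E \<subseteq> triples n \<Longrightarrow> shadow E \<subseteq> edge_pairs n"
  unfolding edge_pairs_def using shadow_subset by blast

text \<open>An edge of \<open>G\<close> and a vertex outside \<open>\<Union>G\<close> span a triple
  with exactly one edge of \<open>G\<close>, and \<open>\<Union>G\<close> has at most
  \<open>2 * card G\<close> vertices. The leading constant is sharp: two edges give nearly 2 n odd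
  triples, as the critical case requires.\<close>

lemma card_odd_triples_ge_small:
  assumes G: "G \<subseteq> edge_pairs n"
  shows "card G * (n - 2 * card G) \<le> card (odd_triples n G)"
proof -
  have finG: "finite G" using G by (rule finite_subset) simp
  have G2: "card e = 2" "e \<subseteq> {1..n}" if "e \<in> G" for e
    using G that by (auto simp: edge_pairs_def)
  have finU: "finite (\<Union>G)"
    by (rule finite_subset[of _ "{1..n}"]) (use G2 in auto)
  define W where "W = {1..n} - \<Union>G"
  have "card (\<Union>G) \<le> (\<Sum>e\<in>G. card e)"
    by (rule card_Union_le_sum_card)
  also have "\<dots> = 2 * card G" using G2 by simp
  finally have "card W \<ge> n - 2 * card G"
    using diff_card_le_card_Diff[OF finU, of "{1..n}"] by (simp add: W_def)
  then have "card G * (n - 2 * card G) \<le> card (G \<times> W)"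
    by (simp add: card_cartesian_product)
  also have "\<dots> \<le> card (odd_triples n G)"
  proof (rule card_inj_on_le)
    have split: "insert w e \<inter> \<Union>G = e" "insert w e - \<Union>G = {w}" if "e \<in> G" "w \<in> W" for e w
      using that by (auto simp: W_def)
    show "inj_on (\<lambda>(e, w). insert w e) (G \<times> W)"
    proof (rule inj_onI, clarify)
      fix e w e' w' assume a: "e \<in> G" "w \<in> W" "e' \<in> G" "w' \<in> W" "insert w e = insert w' e'"
      have "e = e'" using split(1)[of e w] split(1)[of e' w'] a by simp
      moreover have "{w} = {w'}" using split(2)[of e w] split(2)[of e' w'] a by simp
      ultimately show "e = e' \<and> w = w'" by simp
    qed
    show "(\<lambda>(e, w). insert w e) ` (G \<times> W) \<subseteq> odd_triples n G"
    proof clarify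
      fix e w assume ew: "e \<in> G" "w \<in> W"
      then have "w \<notin> e" "w \<in> {1..n}" by (auto simp: W_def)
      then have "insert w e \<in> triples n"
        using G2[OF ew(1)] finite_subset[OF G2(2)[OF ew(1)]] by (auto simp: triples_def)
      moreover have "{e'\<in>G. e' \<subseteq> insert w e} = {e}"
      proof -
        have "e' = e" if e': "e' \<in> G" "e' \<subseteq> insert w e" for e'
        proof -
          have "w \<notin> e'" using e' ew by (auto simp: W_def)
          then have "e' \<subseteq> e" using e' by blast
          then show ?thesis using G2(1)[OF e'(1)] G2(1)[OF ew(1)] by (intro card_subset_eq) (auto intro: card_ge_0_finite)
        qed
        then show ?thesis using ew by auto
      qed
      ultimately show "insert w e \<in> odd_triples n G"
        by (simp add: odd_triples_def)
    qed
    show "finite (odd_triples n G)" by (simp add: odd_triples_def)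
  qed
  finally show ?thesis .
qed

text \<open>The equivalence with a negation says that \<open>G\<close> and the cut disagree at
  \<open>e\<close>; hence no cut agrees with \<open>G\<close> on the whole shadow.\<close>

definition nontrivial_cocycle :: "nat set set \<Rightarrow> nat set set \<Rightarrow> bool" where
  "nontrivial_cocycle E G \<longleftrightarrow> G \<subseteq> shadow E \<and> (\<forall>t\<in>E. even (card {e\<in>G. e \<subseteq> t})) \<and>
     (\<forall>S. \<exists>e\<in>shadow E. e \<in> G \<longleftrightarrow> e \<notin> vertex_cut S)"

lemma cut_symmetric_difference:
  assumes "card e = 2"
  shows "e \<in> vertex_cut ((S - T) \<union> (T - S)) \<longleftrightarrow> (e \<in> vertex_cut S \<longleftrightarrow> e \<notin> vertex_cut T)"
proof -
  obtain u v where "e = {u, v}" "u \<noteq> v" using assms by (auto simp: card_2_iff)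
  then show ?thesis by (auto simp: doubleton_in_cut_iff)
qed

text \<open>The new set is the sum of \<open>G\<close> and the cut of \<open>S\<close> modulo 2,
  restricted to the shadow. A cut meets every triple in an even number of pairs, so parities
  survive; and if the sum were a cut, adding the cut of \<open>S\<close> once more would make
  \<open>G\<close> one.\<close>

lemma nontrivial_cocycle_switch:
  assumes E: "E \<subseteq> triples n" and G: "nontrivial_cocycle E G"
  shows "nontrivial_cocycle E {e\<in>shadow E. e \<in> G \<longleftrightarrow> e \<notin> vertex_cut S}" (is "nontrivial_cocycle E ?H")
  unfolding nontrivial_cocycle_def
proof (intro conjI ballI allI)
  have G2: "\<forall>e\<in>G. card e = 2"
    using G by (auto simp: nontrivial_cocycle_def shadow_def)
  have H2: "\<forall>e\<in>?H. card e = 2"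
    by (auto simp: shadow_def)
  fix t assume t: "t \<in> E"
  then have "card t = 3" using E by (auto simp: triples_def)
  then obtain x y z where xyz: "t = {x, y, z}" "x \<noteq> y" "x \<noteq> z" "y \<noteq> z"
    by (rule card_3_obtain)
  have sh: "{x, y} \<in> shadow E" "{x, z} \<in> shadow E" "{y, z} \<in> shadow E"
    unfolding shadow_def using t xyz by (auto intro!: bexI[of _ t])
  have "even (card {e\<in>G. e \<subseteq> t})"
    using G t by (auto simp: nontrivial_cocycle_def)
  then show "even (card {e\<in>?H. e \<subseteq> t})"
    unfolding xyz(1) card_edges_in_triple[OF G2 xyz(2-4)] card_edges_in_triple[OF H2 xyz(2-4)]
    using sh xyz(2-4)
    by (cases "x \<in> S"; cases "y \<in> S"; cases "z \<in> S"; cases "{x, y} \<in> G"; cases "{x, z} \<in> G"; cases "{y, z} \<in> G")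
       (simp_all add: doubleton_in_cut_iff)
next
  fix T
  obtain e where e: "e \<in> shadow E" "e \<in> G \<longleftrightarrow> e \<notin> vertex_cut ((S - T) \<union> (T - S))"
    using G unfolding nontrivial_cocycle_def by blast
  have "card e = 2" using e by (simp add: shadow_def)
  with e have "e \<in> ?H \<longleftrightarrow> e \<notin> vertex_cut T"
    using cut_symmetric_difference[of e S T] by auto
  then show "\<exists>e\<in>shadow E. e \<in> ?H \<longleftrightarrow> e \<notin> vertex_cut T"
    using e(1) by blast
qed auto

text \<open>
  The coboundary of the neighbourhood of \<open>v\<close> turns \<open>G\<close> into the link of \<open>v\<close>,
  the set of pairs completed by \<open>v\<close> to an odd triple.
\<close>

lemma card_odd_triples_ge_minimal:
  assumes E: "E \<subseteq> triples n" and G: "nontrivial_cocycle E G"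
    and min: "\<And>H. nontrivial_cocycle E H \<Longrightarrow> card G \<le> card H"
  shows "n * card G \<le> 3 * card (odd_triples n G)"
proof -
  have G2: "\<forall>e\<in>G. card e = 2"
    using G by (auto simp: nontrivial_cocycle_def shadow_def)
  have fin: "finite (odd_triples n G)" by (simp add: odd_triples_def)
  have link: "card G \<le> card {t\<in>odd_triples n G. v \<in> t}" if v: "v \<in> {1..n}" for v
  proof -
    define S where "S = {x. {v, x} \<in> G}"
    have vS: "v \<notin> S" using G2 by (force simp: S_def)
    define H where "H = {e\<in>shadow E. e \<in> G \<longleftrightarrow> e \<notin> vertex_cut S}"
    have "card G \<le> card H"
      unfolding H_def by (rule min[OF nontrivial_cocycle_switch[OF E G]])
    also have "\<dots> \<le> card {t\<in>odd_triples n G. v \<in> t}"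
    proof (rule card_inj_on_le)
      \<comment> \<open>At \<open>v\<close> the cut of its neighbourhood agrees with
        \<open>G\<close>, so the switched set has no edge there and \<open>insert v\<close> is
        injective on it.\<close>
      have vH: "v \<notin> e" if e: "e \<in> H" for e
      proof
        assume "v \<in> e"
        moreover have "card e = 2" using e by (simp add: H_def shadow_def)
        ultimately obtain y where y: "e = {v, y}" "v \<noteq> y" by (auto simp: card_2_iff)
        have "e \<in> G \<longleftrightarrow> y \<in> S" by (simp add: S_def y)
        moreover have "e \<in> vertex_cut S \<longleftrightarrow> y \<in> S" using vS y by (simp add: doubleton_in_cut_iff)
        ultimately show False using e by (simp add: H_def)
      qed
      show "inj_on (insert v) H"
        by (rule inj_onI) (use vH in \<open>metis insert_ident\<close>)
      show "insert v ` H \<subseteq> {t\<in>odd_triples n G. v \<in> t}"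
      proof clarify
        fix e assume e: "e \<in> H"
        then have es: "e \<in> shadow E" by (simp add: H_def)
        obtain x y where xy: "e = {x, y}" "x \<noteq> y"
          using shadow_subset(2)[OF E es] by (auto simp: card_2_iff)
        have ne: "v \<noteq> x" "v \<noteq> y" using vH[OF e] xy by auto
        have t: "insert v e \<in> triples n"
          using shadow_subset(1)[OF E es] v xy ne by (auto simp: triples_def card_insert_if)
        have "{x, y} \<in> G \<longleftrightarrow> {x, y} \<notin> vertex_cut S" using e xy by (simp add: H_def)
        then have "{x, y} \<in> G \<longleftrightarrow> \<not> ({v, x} \<in> G \<longleftrightarrow> {v, y} \<notin> G)"
          using doubleton_in_cut_iff[OF xy(2), of S] by (simp add: S_def)
        then have "odd (card {f\<in>G. f \<subseteq> {v, x, y}})"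
          unfolding card_edges_in_triple[OF G2 ne xy(2)] by auto
        then show "insert v e \<in> odd_triples n G \<and> v \<in> insert v e"
          using t xy by (simp add: odd_triples_def)
      qed
      show "finite {t\<in>odd_triples n G. v \<in> t}" using fin by simp
    qed
    finally show ?thesis .
  qed
  \<comment> \<open>Summing over \<open>v\<close> counts each odd triple once for each of its three
    vertices.\<close>
  have "n * card G = (\<Sum>v\<in>{1..n}. card G)" by simp
  also have "\<dots> \<le> (\<Sum>v\<in>{1..n}. card {t\<in>odd_triples n G. v \<in> t})"
    by (intro sum_mono link)
  also have "\<dots> = (\<Sum>v\<in>{1..n}. \<Sum>t\<in>odd_triples n G. of_bool (v \<in> t))"
    using fin by (simp add: Int_def)
  also have "\<dots> = (\<Sum>t\<in>odd_triples n G. \<Sum>v\<in>{1..n}. of_bool (v \<in> t))"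
    by (rule sum.swap)
  also have "\<dots> = (\<Sum>t\<in>odd_triples n G. 3)"
  proof (rule sum.cong)
    fix t assume "t \<in> odd_triples n G"
    then have "t \<subseteq> {1..n}" "card t = 3" by (auto simp: odd_triples_def triples_def)
    then have "{v\<in>{1..n}. v \<in> t} = t" by auto
    then show "(\<Sum>v\<in>{1..n}. of_bool (v \<in> t)) = (3::nat)"
      using \<open>card t = 3\<close> by (simp add: Int_def)
  qed simp
  finally show ?thesis by (simp add: mult.commute)
qed

text \<open>Two different edges of \<open>G\<close> inside a face have that face as their union, so
  by closedness the edges of \<open>G\<close> in a face lie all in \<open>C\<close> or all outside.
  Both parts then inherit even parity, and if both agreed with cuts, so would their sum
  \<open>G\<close>.\<close>

lemma nontrivial_cocycle_split:
  assumes E: "E \<subseteq> triples n" and G: "nontrivial_cocycle E G" and C: "C \<subseteq> G"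
    and closed: "\<And>e f. e \<in> C \<Longrightarrow> f \<in> G \<Longrightarrow> e \<noteq> f \<Longrightarrow> e \<union> f \<in> E \<Longrightarrow> f \<in> C"
  shows "nontrivial_cocycle E C \<or> nontrivial_cocycle E (G - C)"
proof -
  have Gs: "G \<subseteq> shadow E" and Ge: "\<And>t. t \<in> E \<Longrightarrow> even (card {e\<in>G. e \<subseteq> t})"
    using G by (auto simp: nontrivial_cocycle_def)
  have all: "{e\<in>C. e \<subseteq> t} = {} \<or> {e\<in>C. e \<subseteq> t} = {e\<in>G. e \<subseteq> t}" if t: "t \<in> E" for t
  proof (rule disjCI)
    assume "{e\<in>C. e \<subseteq> t} \<noteq> {e\<in>G. e \<subseteq> t}"
    then obtain f where f: "f \<in> G" "f \<subseteq> t" "f \<notin> C" using C by blast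
    have ct: "card t = 3" using t E by (auto simp: triples_def)
    show "{e\<in>C. e \<subseteq> t} = {}"
    proof (rule equals0I)
      fix e assume e: "e \<in> {e\<in>C. e \<subseteq> t}"
      have "e \<union> f = t"
        by (rule union_of_two_edges[OF ct]) (use e f C Gs in \<open>auto simp: shadow_def\<close>)
      then show False using closed[of e f] e f t by auto
    qed
  qed
  have even_C: "even (card {e\<in>C. e \<subseteq> t})" if "t \<in> E" for t
    using all[OF that]
  proof
    assume "{e\<in>C. e \<subseteq> t} = {}"
    then show ?thesis by (simp only: card.empty even_zero)
  qed (use Ge[OF that] in \<open>simp only:\<close>)
  have even_GC: "even (card {e\<in>G - C. e \<subseteq> t})" if t: "t \<in> E" for t
  proof -
    have "{e\<in>G - C. e \<subseteq> t} = {} \<or> {e\<in>G - C. e \<subseteq> t} = {e\<in>G. e \<subseteq> t}"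
      using all[OF t] C by blast
    then show ?thesis
    proof
      assume "{e\<in>G - C. e \<subseteq> t} = {}"
      then show ?thesis by (simp only: card.empty even_zero)
    qed (use Ge[OF t] in \<open>simp only:\<close>)
  qed
  show ?thesis
  proof (rule ccontr)
    assume "\<not> ?thesis"
    then have neg: "\<not> nontrivial_cocycle E C" "\<not> nontrivial_cocycle E (G - C)" by auto
    have sub: "C \<subseteq> shadow E" "G - C \<subseteq> shadow E" using Gs C by auto
    obtain S where S: "\<forall>e\<in>shadow E. \<not> (e \<in> C \<longleftrightarrow> e \<notin> vertex_cut S)"
      using neg(1) sub(1) even_C unfolding nontrivial_cocycle_def by auto
    obtain T where T: "\<forall>e\<in>shadow E. \<not> (e \<in> G - C \<longleftrightarrow> e \<notin> vertex_cut T)"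
      using neg(2) sub(2) even_GC unfolding nontrivial_cocycle_def by auto
    obtain e where e: "e \<in> shadow E" "e \<in> G \<longleftrightarrow> e \<notin> vertex_cut ((S - T) \<union> (T - S))"
      using G unfolding nontrivial_cocycle_def by blast
    have "card e = 2" using e by (simp add: shadow_def)
    then show False
      using e(2) bspec[OF S e(1)] bspec[OF T e(1)] cut_symmetric_difference[of e S T] C by blast
  qed
qed

section \<open>Encoding linked edge sets by walks\<close>

text \<open>
  Depth-first traversal of a labelled rooted tree: \<open>True\<close> descends along the next label,
  \<open>False\<close> returns to the parent. The result lists the vertices in the order of the visits,
  so a tree with \<open>k\<close> edges is encoded by \<open>2 * k\<close> bits and \<open>k\<close> labels.
\<close>

fun tree_walk :: "('a \<Rightarrow> 'x \<Rightarrow> 'a) \<Rightarrow> 'a list \<Rightarrow> bool list \<Rightarrow> 'x list \<Rightarrow> 'a list" where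
  "tree_walk nb st [] xs = [hd st]"
| "tree_walk nb st (True # bs) (x # xs) = hd st # tree_walk nb (nb (hd st) x # st) bs xs"
| "tree_walk nb st (True # bs) [] = [hd st]"
| "tree_walk nb st (False # bs) xs = hd st # tree_walk nb (tl st) bs xs"

lemma tree_walk_Cons: "\<exists>zs. tree_walk nb st bs xs = hd st # zs"
  by (cases "(nb, st, bs, xs)" rule: tree_walk.cases) auto

text \<open>A leaf is attached at a chosen visit of \<open>g\<close> by inserting the detour
  \<open>True\<close>, \<open>False\<close> and the label \<open>x\<close> at the matching places of
  the code; the new walk is at \<open>g\<close> both before and after the leaf.\<close>

lemma tree_walk_insert:
  assumes "tree_walk nb st bs xs = ys @ g # zs"
  shows "\<exists>bs' xs'. length bs' = Suc (Suc (length bs)) \<and> length xs' = Suc (length xs) \<and>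
    set xs' = insert x (set xs) \<and> tree_walk nb st bs' xs' = ys @ g # nb g x # g # zs"
  using assms
proof (induction nb st bs xs arbitrary: ys rule: tree_walk.induct)
  have start: "\<exists>bs' xs'. length bs' = Suc (Suc (length bs)) \<and> length xs' = Suc (length xs) \<and>
      set xs' = insert x (set xs) \<and> tree_walk nb st bs' xs' = [] @ g # nb g x # g # zs"
    if "tree_walk nb st bs xs = [] @ g # zs" for nb :: "'a \<Rightarrow> 'b \<Rightarrow> 'a" and st bs xs
    using that tree_walk_Cons[of nb st bs xs]
    by (intro exI[of _ "True # False # bs"] exI[of _ "x # xs"]) auto
  {
    case (1 nb st xs)
    then show ?case using start[of nb st "[]" xs] by (cases ys) auto
  next
    case (2 nb st bs y xs)
    show ?case
    proof (cases ys)
      case Nil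
      then have "tree_walk nb st (True # bs) (y # xs) = [] @ g # zs" using 2(2) by (simp only:)
      from start[OF this] show ?thesis by (simp only: Nil)
    next
      case (Cons w ws)
      then have "tree_walk nb (nb (hd st) y # st) bs xs = ws @ g # zs" "w = hd st"
        using 2 by auto
      with 2(1)[of ws] obtain bs' xs' where "length bs' = Suc (Suc (length bs))" "length xs' = Suc (length xs)"
        "set xs' = insert x (set xs)" "tree_walk nb (nb (hd st) y # st) bs' xs' = ws @ g # nb g x # g # zs"
        by blast
      then show ?thesis using Cons \<open>w = hd st\<close>
        by (intro exI[of _ "True # bs'"] exI[of _ "y # xs'"]) auto
    qed
  next
    case (3 nb st bs)
    then show ?case using start[of nb st "True # bs" "[]"] by (cases ys) auto
  next
    case (4 nb st bs xs)
    show ?case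
    proof (cases ys)
      case Nil
      then have "tree_walk nb st (False # bs) xs = [] @ g # zs" using 4(2) by (simp only:)
      from start[OF this] show ?thesis by (simp only: Nil)
    next
      case (Cons w ws)
      then have "tree_walk nb (tl st) bs xs = ws @ g # zs" "w = hd st"
        using 4 by auto
      with 4(1)[of ws] obtain bs' xs' where "length bs' = Suc (Suc (length bs))" "length xs' = Suc (length xs)"
        "set xs' = insert x (set xs)" "tree_walk nb (tl st) bs' xs' = ws @ g # nb g x # g # zs"
        by blast
      then show ?thesis using Cons \<open>w = hd st\<close>
        by (intro exI[of _ "False # bs'"] exI[of _ "xs'"]) auto
    qed
  }
qed

text \<open>In a traversal, consecutive entries are a parent and a child in either order, and their
  union is the triple containing both. As a set is formed, an edge of the tree contributes one link
  although it is traversed twice.\<close>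

fun links :: "'a set list \<Rightarrow> 'a set set" where
  "links (a # b # xs) = insert (a \<union> b) (links (b # xs))"
| "links _ = {}"

lemma links_append: "links (ys @ g # zs) = links (ys @ [g]) \<union> links (g # zs)"
proof (induction ys)
  case (Cons y ys)
  then show ?case by (cases ys) auto
qed simp

lemma links_insert: "links (ys @ g # f # g # zs) = insert (g \<union> f) (links (ys @ g # zs))"
  unfolding links_append[of ys g "f # g # zs"] links_append[of ys g zs] by (auto simp: Un_commute)

text \<open>Distinct pairs inside a triple share an endpoint. The parity of the label tells which
  endpoint of \<open>e\<close> is kept, its half is the new one; with halves from 0 to n,
  \<open>2 * n + 2\<close> labels suffice.\<close>

definition adjacent_edge :: "nat set \<Rightarrow> nat \<Rightarrow> nat set" where
  "adjacent_edge e i = (if even i then {Min e, i div 2} else {Max e, i div 2})"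

lemma adjacent_edge_surj:
  assumes "card e = 2" "card f = 2" "e \<noteq> f" "e \<union> f \<in> triples n"
  obtains i where "i < 2 * n + 2" "adjacent_edge e i = f"
proof -
  have fin: "finite e" "finite f" using assms by (auto intro: card_ge_0_finite)
  have "card (e \<inter> f) = 1"
    using card_Un_Int[OF fin] assms by (simp add: triples_def)
  then obtain h where h: "e \<inter> f = {h}" by (auto simp: card_1_singleton_iff)
  then have "h \<in> f" "h \<in> e" by auto
  then obtain z where z: "f = {h, z}" using assms(2) by (auto simp: card_2_iff)
  then have zn: "z \<le> n" using assms(4) by (auto simp: triples_def)
  obtain a b where ab: "e = {a, b}" "a < b"
    using assms(1) by (auto simp: card_2_iff) (metis insert_commute linorder_neqE_nat)
  then have "Min e = a" "Max e = b" by auto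
  moreover have "h = a \<or> h = b" using \<open>h \<in> e\<close> ab by auto
  ultimately have "adjacent_edge e (2 * z) = f \<or> adjacent_edge e (2 * z + 1) = f"
    using z by (auto simp: adjacent_edge_def)
  then show ?thesis using that[of "2 * z"] that[of "2 * z + 1"] zn by auto
qed

text \<open>Codes that do not describe a tree of edges linked by triples are included as well, which
  does no harm to an upper bound.\<close>

definition edge_walks :: "nat \<Rightarrow> nat \<Rightarrow> nat set list set" where
  "edge_walks n k = (\<lambda>(e, bs, xs). tree_walk adjacent_edge [e] bs xs) `
     (edge_pairs n \<times> {bs. set bs \<subseteq> UNIV \<and> length bs = 2 * k} \<times> {xs. set xs \<subseteq> {..<2 * n + 2} \<and> length xs = k})"

lemma finite_edge_walks [simp]: "finite (edge_walks n k)"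
  unfolding edge_walks_def
  by (intro finite_imageI finite_cartesian_product finite_edge_pairs finite_lists_length_eq) auto

lemma card_edge_walks_le: "card (edge_walks n k) \<le> n\<^sup>2 * (4 * (2 * n + 2)) ^ k"
proof -
  have "card (edge_walks n k) \<le> card (edge_pairs n \<times> {bs. set bs \<subseteq> (UNIV :: bool set) \<and> length bs = 2 * k} \<times>
      {xs. set xs \<subseteq> {..<2 * n + 2} \<and> length xs = k})"
    unfolding edge_walks_def
    by (intro card_image_le finite_cartesian_product finite_edge_pairs finite_lists_length_eq) auto
  also have "\<dots> = card (edge_pairs n) * (2 ^ (2 * k) * (2 * n + 2) ^ k)"
    unfolding card_cartesian_product
    using card_lists_length_eq[of "UNIV :: bool set" "2 * k"] card_lists_length_eq[of "{..<2 * n + 2}" k]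
    by simp
  also have "\<dots> \<le> n\<^sup>2 * (2 ^ (2 * k) * (2 * n + 2) ^ k)"
    using card_edge_pairs_le by (intro mult_right_mono) auto
  also have "\<dots> = n\<^sup>2 * (4 * (2 * n + 2)) ^ k"
    by (simp only: power_mult power_mult_distrib) simp
  finally show ?thesis .
qed

text \<open>The tree grows by one edge of \<open>G\<close> at a time: if no face joined
  \<open>set w\<close> to the rest of \<open>G\<close>, splitting would yield a smaller nontrivial
  cocycle. The last clause is the invariant that keeps the links distinct. A face contains at most
  two edges of \<open>G\<close>, so one with two edges in \<open>set w\<close> cannot lead to a new
  edge.\<close>

lemma minimal_cocycle_walk:
  assumes E: "E \<subseteq> triples n" and G: "nontrivial_cocycle E G"
    and min: "\<And>H. nontrivial_cocycle E H \<Longrightarrow> card G \<le> card H"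
    and k: "k < card G"
  shows "\<exists>w\<in>edge_walks n k. set w \<subseteq> G \<and> card (set w) = Suc k \<and> links w \<subseteq> E \<and> card (links w) = k \<and>
    (\<forall>t\<in>links w. 2 \<le> card {e\<in>set w. e \<subseteq> t})"
  using k
proof (induction k)
  case 0
  then obtain e where e: "e \<in> G" by fastforce
  have "e \<in> edge_pairs n"
    using e G shadow_subset_edge_pairs[OF E] by (auto simp: nontrivial_cocycle_def)
  then have "[e] \<in> edge_walks n 0"
    unfolding edge_walks_def by (intro image_eqI[of _ _ "(e, [], [])"]) auto
  then show ?case using e by (intro bexI[of _ "[e]"]) auto
next
  case (Suc k)
  then obtain w where w: "w \<in> edge_walks n k" "set w \<subseteq> G" "card (set w) = Suc k" "links w \<subseteq> E"
      "card (links w) = k" and lw: "\<And>t. t \<in> links w \<Longrightarrow> 2 \<le> card {e\<in>set w. e \<subseteq> t}"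
    by auto
  have Gs: "G \<subseteq> shadow E" and Ge: "\<And>t. t \<in> E \<Longrightarrow> even (card {e\<in>G. e \<subseteq> t})"
    using G by (auto simp: nontrivial_cocycle_def)
  have finG: "finite G"
    using Gs shadow_subset_edge_pairs[OF E] finite_edge_pairs finite_subset by metis
  have G2: "\<forall>e\<in>G. card e = 2" using Gs by (auto simp: shadow_def)
  have "\<exists>e\<in>set w. \<exists>f\<in>G - set w. e \<union> f \<in> E"
  proof (rule ccontr)
    assume "\<not> ?thesis"
    then have "nontrivial_cocycle E (set w) \<or> nontrivial_cocycle E (G - set w)"
      by (intro nontrivial_cocycle_split[OF E G w(2)]) auto
    then have "card G \<le> card (set w) \<or> card G \<le> card (G - set w)" using min by blast
    moreover have "card (G - set w) = card G - Suc k"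
      using w finG by (simp add: card_Diff_subset)
    ultimately show False using w(3) Suc.prems by auto
  qed
  then obtain e f where ef: "e \<in> set w" "f \<in> G" "f \<notin> set w" "e \<union> f \<in> E" by blast
  have eG: "e \<in> G" using ef w by blast
  have tr: "e \<union> f \<in> triples n" using ef E by blast
  have ne: "e \<noteq> f" using ef by blast
  obtain i where i: "i < 2 * n + 2" "adjacent_edge e i = f"
    using adjacent_edge_surj[OF bspec[OF G2 eG] bspec[OF G2 ef(2)] ne tr] .
  obtain ys zs where yz: "w = ys @ e # zs" using ef(1) by (auto simp: in_set_conv_decomp)
  obtain r bs xs where rbx: "r \<in> edge_pairs n" "length bs = 2 * k" "set xs \<subseteq> {..<2 * n + 2}" "length xs = k"
      "w = tree_walk adjacent_edge [r] bs xs"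
    using w(1) by (auto simp: edge_walks_def)
  obtain bs' xs' where bx: "length bs' = Suc (Suc (length bs))" "length xs' = Suc (length xs)"
      "set xs' = insert i (set xs)" "tree_walk adjacent_edge [r] bs' xs' = ys @ e # f # e # zs"
    using tree_walk_insert[of adjacent_edge "[r]" bs xs ys e zs i] rbx yz i by metis
  define w' where "w' = ys @ e # f # e # zs"
  have w'_mem: "w' \<in> edge_walks n (Suc k)"
    unfolding edge_walks_def
    by (rule image_eqI[of _ _ "(r, bs', xs')"]) (use bx rbx i in \<open>auto simp: w'_def\<close>)
  have set_w': "set w' = insert f (set w)" by (auto simp: w'_def yz)
  have links_w': "links w' = insert (e \<union> f) (links w)"
    unfolding w'_def yz by (rule links_insert)
  \<comment> \<open>There are only three pairs in a face, and an even number of them belongs to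
    \<open>G\<close>.\<close>
  have three: "card {g\<in>G. g \<subseteq> e \<union> f} \<le> 2"
  proof -
    obtain x y z where xyz: "e \<union> f = {x, y, z}" "x \<noteq> y" "x \<noteq> z" "y \<noteq> z"
      using tr card_3_obtain[of "e \<union> f"] by (auto simp: triples_def)
    have "card {g\<in>G. g \<subseteq> e \<union> f} \<le> 3"
      unfolding xyz(1) card_edges_in_triple[OF G2 xyz(2-4)] by (auto simp: of_bool_def)
    moreover have "card {g\<in>G. g \<subseteq> e \<union> f} \<noteq> 3" using Ge[OF ef(4)] by auto
    ultimately show ?thesis by simp
  qed
  have "e \<union> f \<notin> links w"
  proof
    assume "e \<union> f \<in> links w"
    then have "2 \<le> card {g\<in>set w. g \<subseteq> e \<union> f}" by (rule lw)
    moreover have "card (insert f {g\<in>set w. g \<subseteq> e \<union> f}) \<le> card {g\<in>G. g \<subseteq> e \<union> f}"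
      using ef w(2) finG by (intro card_mono) auto
    ultimately show False using three ef by (simp add: card_insert_if)
  qed
  moreover have "finite (links w)"
    using w(4) E finite_triples finite_subset by (metis order_trans)
  ultimately have card_links: "card (links w') = Suc k" using w by (simp add: links_w')
  have "2 \<le> card {g\<in>set w'. g \<subseteq> t}" if t: "t \<in> links w'" for t
  proof (cases "t \<in> links w")
    case True
    have "2 \<le> card {g\<in>set w. g \<subseteq> t}" by (rule lw[OF True])
    also have "\<dots> \<le> card {g\<in>set w'. g \<subseteq> t}" by (intro card_mono) (auto simp: set_w')
    finally show ?thesis .
  next
    case False
    then have "t = e \<union> f" using t by (simp add: links_w')
    then have "card {e, f} \<le> card {g\<in>set w'. g \<subseteq> t}"
      using ef by (intro card_mono) (auto simp: set_w')
    then show ?thesis using ne by simp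
  qed
  then show ?case
    using w'_mem set_w' links_w' card_links w ef by (intro bexI[of _ w']) auto
qed

text \<open>The traversal of a smallest nontrivial cocycle exhausts it, so \<open>k + 1\<close> is
  its size. This is at least two, because a single edge would be the only one in a face through
  it.\<close>

lemma nontrivial_cocycle_walk:
  assumes E: "E \<subseteq> triples n" and G: "nontrivial_cocycle E G"
  obtains k w where "1 \<le> k" "k < n\<^sup>2" "w \<in> edge_walks n k" "set w \<subseteq> edge_pairs n" "card (set w) = Suc k"
    "links w \<subseteq> E" "card (links w) = k" "odd_triples n (set w) \<inter> E = {}"
    "n * Suc k \<le> 3 * card (odd_triples n (set w))"
proof -
  obtain G where G: "nontrivial_cocycle E G" and min: "\<And>H. nontrivial_cocycle E H \<Longrightarrow> card G \<le> card H"
    using ex_has_least_nat[of "nontrivial_cocycle E" G card] G by blast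
  have Gs: "G \<subseteq> shadow E" and Ge: "\<And>t. t \<in> E \<Longrightarrow> even (card {e\<in>G. e \<subseteq> t})"
    using G by (auto simp: nontrivial_cocycle_def)
  have Gp: "G \<subseteq> edge_pairs n" using Gs shadow_subset_edge_pairs[OF E] by blast
  have finG: "finite G" using Gp by (rule finite_subset) simp
  have "G \<noteq> {}"
  proof
    assume "G = {}"
    moreover obtain e where "e \<in> G \<longleftrightarrow> e \<notin> vertex_cut {}"
      using G unfolding nontrivial_cocycle_def by blast
    ultimately show False by (simp add: vertex_cut_def)
  qed
  moreover have "card G \<noteq> 1"
  proof
    assume "card G = 1"
    then obtain e where e: "G = {e}" by (auto simp: card_1_singleton_iff)
    then obtain t where t: "t \<in> E" "e \<subseteq> t" using Gs by (auto simp: shadow_def)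
    then have "{f\<in>G. f \<subseteq> t} = {e}" using e by auto
    with Ge[OF t(1)] show False by simp
  qed
  ultimately have c2: "card G \<ge> 2" using finG by (metis One_nat_def Suc_leI card_gt_0_iff le_neq_implies_less numeral_2_eq_2)
  obtain w where w: "w \<in> edge_walks n (card G - 1)" "set w \<subseteq> G" "card (set w) = Suc (card G - 1)"
      "links w \<subseteq> E" "card (links w) = card G - 1"
    using minimal_cocycle_walk[OF E G min, of "card G - 1"] c2 by auto
  have wG: "set w = G" using w c2 finG by (intro card_subset_eq) auto
  have "card G \<le> n\<^sup>2" using card_mono[OF finite_edge_pairs Gp] card_edge_pairs_le by (rule order_trans)
  moreover have "odd_triples n G \<inter> E = {}" using Ge by (auto simp: odd_triples_def)
  moreover have "n * card G \<le> 3 * card (odd_triples n G)"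
    by (rule card_odd_triples_ge_minimal[OF E G min])
  ultimately show ?thesis
    using that[of "card G - 1" w] w wG c2 Gp by auto
qed

section \<open>Above the threshold\<close>

text \<open>A full star at \<open>r\<close> is a stronger demand than a connected shadow, but each
  of its edges lies in n - 2 triples, so a union bound succeeds as soon as n p - log n tends to
  infinity.\<close>

lemma prob_star_fails_le:
  assumes p: "0 \<le> p" "p \<le> 1" and r: "r \<in> {1..n}"
  shows "hypergraph_prob n p (\<lambda>E. \<exists>v\<in>{1..n}. v \<noteq> r \<and> {r, v} \<notin> shadow E) \<le> real n * (1 - p) ^ (n - 2)"
proof -
  let ?N = "\<lambda>v. {s\<in>triples n. {r, v} \<subseteq> s}"
  have card_N: "n - 2 \<le> card (?N v)" if v: "v \<in> {1..n} - {r}" for v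
  proof -
    have "n - 2 = card ({1..n} - {r, v})"
      using v r by (subst card_Diff_subset) auto
    also have "\<dots> \<le> card (?N v)"
    proof (rule card_inj_on_le)
      show "inj_on (\<lambda>w. insert w {r, v}) ({1..n} - {r, v})"
        by (auto simp: inj_on_def)
      show "(\<lambda>w. insert w {r, v}) ` ({1..n} - {r, v}) \<subseteq> ?N v"
        using v r by (auto simp: triples_def card_insert_if)
    qed auto
    finally show ?thesis .
  qed
  have "hypergraph_prob n p (\<lambda>E. \<exists>v\<in>{1..n}. v \<noteq> r \<and> {r, v} \<notin> shadow E)
      \<le> hypergraph_prob n p (\<lambda>E. \<exists>v\<in>{1..n} - {r}. {} \<subseteq> E \<and> ?N v \<inter> E = {})"
    by (rule prob_random_hypergraph_mono) (auto simp: shadow_def)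
  also have "\<dots> \<le> (\<Sum>v\<in>{1..n} - {r}. hypergraph_prob n p (\<lambda>E. {} \<subseteq> E \<and> ?N v \<inter> E = {}))"
    by (rule prob_pmf_Bex_le) simp
  also have "\<dots> \<le> (\<Sum>v\<in>{1..n} - {r}. (1 - p) ^ (n - 2))"
  proof (rule sum_mono)
    fix v assume v: "v \<in> {1..n} - {r}"
    have "hypergraph_prob n p (\<lambda>E. {} \<subseteq> E \<and> ?N v \<inter> E = {}) = p ^ card ({} :: nat set set) * (1 - p) ^ card (?N v)"
      by (rule prob_random_hypergraph) (use p in auto)
    also have "\<dots> \<le> (1 - p) ^ (n - 2)"
      using p card_N[OF v] by (simp add: power_decreasing)
    finally show "hypergraph_prob n p (\<lambda>E. {} \<subseteq> E \<and> ?N v \<inter> E = {}) \<le> (1 - p) ^ (n - 2)" .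
  qed
  also have "\<dots> = real (card ({1..n} - {r})) * (1 - p) ^ (n - 2)" by simp
  also have "\<dots> \<le> real n * (1 - p) ^ (n - 2)"
    using p r by (intro mult_right_mono) auto
  finally show ?thesis .
qed

text \<open>Unless the event is impossible, the required links and the forbidden odd triples are
  different triples, and independence gives the product.\<close>

lemma prob_walk_le:
  assumes p: "0 \<le> p" "p \<le> 1" and w: "card (links w) = k" "real (card (odd_triples n (set w))) \<ge> l"
  shows "hypergraph_prob n p (\<lambda>E. E \<subseteq> triples n \<and> links w \<subseteq> E \<and> odd_triples n (set w) \<inter> E = {}) \<le> p ^ k * exp (- (l * p))"
proof (cases "links w \<subseteq> triples n \<and> links w \<inter> odd_triples n (set w) = {}")
  case True
  have "hypergraph_prob n p (\<lambda>E. E \<subseteq> triples n \<and> links w \<subseteq> E \<and> odd_triples n (set w) \<inter> E = {})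
      \<le> hypergraph_prob n p (\<lambda>E. links w \<subseteq> E \<and> odd_triples n (set w) \<inter> E = {})"
    by (rule prob_random_hypergraph_mono) auto
  also have "\<dots> = p ^ k * (1 - p) ^ card (odd_triples n (set w))"
    using True p w(1) by (subst prob_random_hypergraph) (auto simp: odd_triples_def)
  also have "\<dots> \<le> p ^ k * exp (- (l * p))"
  proof (rule mult_left_mono)
    have "(1 - p) ^ card (odd_triples n (set w)) \<le> exp (- (real (card (odd_triples n (set w))) * p))"
      by (rule one_minus_power_le_exp[OF p(2)])
    also have "\<dots> \<le> exp (- (l * p))"
      using w(2) p by (simp add: mult_right_mono)
    finally show "(1 - p) ^ card (odd_triples n (set w)) \<le> exp (- (l * p))" .
  qed (use p in simp)
  finally show ?thesis .
next
  case False
  then have "{E. E \<subseteq> triples n \<and> links w \<subseteq> E \<and> odd_triples n (set w) \<inter> E = {}} = {}"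
    by blast
  then have "hypergraph_prob n p (\<lambda>E. E \<subseteq> triples n \<and> links w \<subseteq> E \<and> odd_triples n (set w) \<inter> E = {}) = 0"
    by (simp only: measure_empty)
  then show ?thesis using p by simp
qed

text \<open>Union bound over walks with \<open>k\<close> links. \<open>l k\<close> is the better of
  the two lower bounds for the odd triples of a minimal cocycle with \<open>k + 1\<close> edges; the
  constant 16 comes from 4 (2 n + 2) \<le> 16 n.\<close>

lemma prob_nontrivial_cocycle_le_sum:
  fixes n :: nat and p :: real
  defines "l \<equiv> \<lambda>k. max (real n * real (Suc k) / 3) (real (Suc k) * (real n - 2 * real (Suc k)))"
  assumes p: "0 \<le> p" "p \<le> 1" and n: "n \<ge> 1"
  shows "hypergraph_prob n p (\<lambda>E. \<exists>G. nontrivial_cocycle E G)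
    \<le> (\<Sum>k\<in>{1..<n\<^sup>2}. (real n)\<^sup>2 * (16 * (real n * p)) ^ k * exp (- (l k * p)))"
proof -
  define good where "good = (\<lambda>k w. card (links w) = k \<and> l k \<le> real (card (odd_triples n (set w))))"
  define ev where "ev = (\<lambda>w E. E \<subseteq> triples n \<and> links w \<subseteq> E \<and> odd_triples n (set w) \<inter> E = {})"
  have "hypergraph_prob n p (\<lambda>E. \<exists>G. nontrivial_cocycle E G)
      \<le> hypergraph_prob n p (\<lambda>E. \<exists>k\<in>{1..<n\<^sup>2}. \<exists>w\<in>{w\<in>edge_walks n k. good k w}. ev w E)"
  proof (rule prob_random_hypergraph_mono)
    fix E assume E: "E \<subseteq> triples n" "\<exists>G. nontrivial_cocycle E G"
    then obtain k w where kw: "1 \<le> k" "k < n\<^sup>2" "w \<in> edge_walks n k" "set w \<subseteq> edge_pairs n" "card (set w) = Suc k"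
        "links w \<subseteq> E" "card (links w) = k" "odd_triples n (set w) \<inter> E = {}"
        "n * Suc k \<le> 3 * card (odd_triples n (set w))"
      using nontrivial_cocycle_walk[OF E(1)] by metis
    have "real (n * Suc k) \<le> real (3 * card (odd_triples n (set w)))"
      using kw(9) by (rule of_nat_mono)
    then have "real n * real (Suc k) / 3 \<le> real (card (odd_triples n (set w)))"
      by (simp only: of_nat_mult)
    moreover have "real (Suc k) * (real n - 2 * real (Suc k)) \<le> real (card (odd_triples n (set w)))"
    proof -
      have "real (Suc k) * (real n - 2 * real (Suc k)) \<le> real (Suc k) * real (n - 2 * Suc k)"
        by (intro mult_left_mono) auto
      also have "\<dots> = real (Suc k * (n - 2 * Suc k))" by (simp only: of_nat_mult)
      also have "\<dots> \<le> real (card (odd_triples n (set w)))"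
        using card_odd_triples_ge_small[OF kw(4)] unfolding kw(5) by (rule of_nat_mono)
      finally show ?thesis .
    qed
    ultimately have "l k \<le> real (card (odd_triples n (set w)))" by (simp add: l_def)
    then have "good k w" "ev w E" using kw E by (auto simp: good_def ev_def)
    then show "\<exists>k\<in>{1..<n\<^sup>2}. \<exists>w\<in>{w\<in>edge_walks n k. good k w}. ev w E"
      using kw by (intro bexI[of _ k] bexI[of _ w]) auto
  qed
  also have "\<dots> \<le> (\<Sum>k\<in>{1..<n\<^sup>2}. hypergraph_prob n p (\<lambda>E. \<exists>w\<in>{w\<in>edge_walks n k. good k w}. ev w E))"
    by (rule prob_pmf_Bex_le) simp
  also have "\<dots> \<le> (\<Sum>k\<in>{1..<n\<^sup>2}. (real n)\<^sup>2 * (16 * (real n * p)) ^ k * exp (- (l k * p)))"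
  proof (rule sum_mono)
    fix k
    have "hypergraph_prob n p (\<lambda>E. \<exists>w\<in>{w\<in>edge_walks n k. good k w}. ev w E)
        \<le> (\<Sum>w\<in>{w\<in>edge_walks n k. good k w}. hypergraph_prob n p (ev w))"
      by (rule prob_pmf_Bex_le) simp
    also have "\<dots> \<le> (\<Sum>w\<in>{w\<in>edge_walks n k. good k w}. p ^ k * exp (- (l k * p)))"
      unfolding ev_def by (intro sum_mono prob_walk_le p) (auto simp: good_def)
    also have "\<dots> = real (card {w\<in>edge_walks n k. good k w}) * (p ^ k * exp (- (l k * p)))" by simp
    also have "\<dots> \<le> ((real n)\<^sup>2 * (16 * real n) ^ k) * (p ^ k * exp (- (l k * p)))"
    proof (rule mult_right_mono)
      have "card {w\<in>edge_walks n k. good k w} \<le> card (edge_walks n k)"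
        by (intro card_mono) auto
      also have "\<dots> \<le> n\<^sup>2 * (4 * (2 * n + 2)) ^ k" by (rule card_edge_walks_le)
      also have "\<dots> \<le> n\<^sup>2 * (16 * n) ^ k"
        using n by (intro mult_left_mono power_mono) auto
      finally have "real (card {w\<in>edge_walks n k. good k w}) \<le> real (n\<^sup>2 * (16 * n) ^ k)"
        by (rule of_nat_mono)
      then show "real (card {w\<in>edge_walks n k. good k w}) \<le> (real n)\<^sup>2 * (16 * real n) ^ k" by simp
    qed (use p in simp)
    also have "\<dots> = (real n)\<^sup>2 * (16 * (real n * p)) ^ k * exp (- (l k * p))"
      by (simp add: power_mult_distrib mult_ac)
    finally show "hypergraph_prob n p (\<lambda>E. \<exists>w\<in>{w\<in>edge_walks n k. good k w}. ev w E)
        \<le> (real n)\<^sup>2 * (16 * (real n * p)) ^ k * exp (- (l k * p))" .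
  qed
  finally show ?thesis .
qed

section \<open>Summation over the sizes of cocycles\<close>

lemma sum_geometric_tail_le:
  fixes x :: real
  assumes "0 \<le> x" "x \<le> 1/2"
  shows "(\<Sum>k\<in>{a..<b}. x ^ k) \<le> 2 * x ^ a"
proof -
  have le: "(\<Sum>k\<in>{a..<b}. x ^ k) \<le> 2 * x ^ a - 2 * x ^ b" if "a \<le> b" for b
    using that
  proof (induction b rule: dec_induct)
    case (step b)
    have "2 * x ^ Suc b \<le> x ^ b" using assms mult_right_mono[of "2 * x" 1 "x ^ b"] by simp
    then show ?case using step by simp
  qed simp
  show ?thesis
  proof (cases "a \<le> b")
    case True
    have "x ^ b \<ge> 0" using assms by simp
    then show ?thesis using le[OF True] by linarith
  qed (use assms in simp)
qed

text \<open>
  Cocycles with at most six edges are dominated by those with two edges, which are critical;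
  for larger ones the bound \<open>n * card G / 3\<close> on the number of odd triples suffices.
\<close>

lemma prob_nontrivial_cocycle_le:
  fixes n :: nat and p :: real
  defines "c \<equiv> real n * p"
  assumes p: "0 \<le> p" "p \<le> 1" and n: "n \<ge> 1"
    and c: "16 * c * exp (- (c / 3)) \<le> 1/2" "ln (real n) \<le> c"
  shows "hypergraph_prob n p (\<lambda>E. \<exists>G. nontrivial_cocycle E G)
    \<le> 80 * exp 72 * ((real n)\<^sup>2 * c * exp (- (2 * c))) + 2 * (16 * c) ^ 6 * exp (- (c / 3))"
proof -
  define x where "x = 16 * c * exp (- (c / 3))"
  define T where "T = (\<lambda>k. (real n)\<^sup>2 * (16 * c) ^ k *
    exp (- (max (real n * real (Suc k) / 3) (real (Suc k) * (real n - 2 * real (Suc k))) * p)))"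
  have c0: "c \<ge> 0" using p by (simp add: c_def)
  have x0: "0 \<le> x" "x \<le> 1/2" using c0 c by (auto simp: x_def)
  have T0: "T k \<ge> 0" for k using c0 by (simp add: T_def)
  \<comment> \<open>At most six edges, so the loss 2 (k + 1)^2 p in the exponent is at most 72;
    every edge beyond the second contributes a factor 16 c exp (- c) \<le> 1.\<close>
  have small: "T k \<le> 16 * exp 72 * ((real n)\<^sup>2 * c * exp (- (2 * c)))" if k: "k \<in> {1..<6}" for k
  proof -
    have "real (Suc k) * (real n - 2 * real (Suc k)) * p = real (Suc k) * c - 2 * (real (Suc k))\<^sup>2 * p"
      by (simp add: c_def algebra_simps power2_eq_square)
    moreover have "(real (Suc k))\<^sup>2 \<le> 6\<^sup>2" using k by (intro power_mono) auto
    then have "2 * (real (Suc k))\<^sup>2 * p \<le> 72 * 1" using p by (intro mult_mono) auto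
    ultimately have "real (Suc k) * c - 72 \<le> real (Suc k) * (real n - 2 * real (Suc k)) * p" by linarith
    also have "\<dots> \<le> max (real n * real (Suc k) / 3) (real (Suc k) * (real n - 2 * real (Suc k))) * p"
      using p by (intro mult_right_mono) auto
    finally have "T k \<le> (real n)\<^sup>2 * (16 * c) ^ k * exp (72 - real (Suc k) * c)"
      unfolding T_def using c0 by (intro mult_left_mono) auto
    also have "\<dots> = 16 * exp 72 * ((real n)\<^sup>2 * c * exp (- (2 * c))) * (16 * c * exp (- c)) ^ (k - 1)"
    proof -
      obtain j where j: "k = Suc j" using k by (cases k) auto
      have "72 - real (Suc k) * c = 72 + (- (2 * c)) + real j * (- c)" by (simp add: j algebra_simps)
      then have "exp (72 - real (Suc k) * c) = exp 72 * exp (- (2 * c)) * exp (- c) ^ j"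
        by (simp only: exp_add exp_of_nat_mult)
      then show ?thesis by (simp add: j power_mult_distrib)
    qed
    also have "\<dots> \<le> 16 * exp 72 * ((real n)\<^sup>2 * c * exp (- (2 * c))) * 1"
    proof (rule mult_left_mono)
      have "16 * c * exp (- c) \<le> x" unfolding x_def using c0 by (intro mult_left_mono) auto
      then show "(16 * c * exp (- c)) ^ (k - 1) \<le> 1"
        using x0 c0 by (intro power_le_one) auto
    qed (use c0 in simp)
    finally show ?thesis by simp
  qed
  have large: "T k \<le> (real n)\<^sup>2 * exp (- (c / 3)) * x ^ k" for k
  proof -
    have "real (Suc k) * c / 3 = real n * real (Suc k) / 3 * p" by (simp add: c_def)
    also have "\<dots> \<le> max (real n * real (Suc k) / 3) (real (Suc k) * (real n - 2 * real (Suc k))) * p"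
      using p by (intro mult_right_mono) auto
    finally have "T k \<le> (real n)\<^sup>2 * (16 * c) ^ k * exp (- (real (Suc k) * c / 3))"
      unfolding T_def using c0 by (intro mult_left_mono) auto
    also have "\<dots> = (real n)\<^sup>2 * exp (- (c / 3)) * x ^ k"
    proof -
      have "- (real (Suc k) * c / 3) = - (c / 3) + real k * (- (c / 3))" by (simp add: algebra_simps)
      then have "exp (- (real (Suc k) * c / 3)) = exp (- (c / 3)) * exp (- (c / 3)) ^ k"
        by (simp only: exp_add exp_of_nat_mult)
      then show ?thesis by (simp add: x_def power_mult_distrib)
    qed
    finally show ?thesis .
  qed
  have n2: "(real n)\<^sup>2 * exp (- (2 * c)) \<le> 1"
  proof -
    have "real n = exp (ln (real n))" using n by simp
    also have "\<dots> \<le> exp c" using c(2) by simp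
    finally have "real n \<le> exp c" .
    then have "(real n)\<^sup>2 \<le> (exp c)\<^sup>2" by (intro power_mono) auto
    also have "\<dots> = exp (2 * c)" by (simp add: exp_double)
    finally show ?thesis by (simp add: exp_minus field_simps)
  qed
  have "hypergraph_prob n p (\<lambda>E. \<exists>G. nontrivial_cocycle E G) \<le> (\<Sum>k\<in>{1..<n\<^sup>2}. T k)"
    unfolding T_def c_def by (rule prob_nontrivial_cocycle_le_sum[OF p n])
  also have "\<dots> \<le> (\<Sum>k\<in>{1..<6} \<union> {6..<n\<^sup>2}. T k)"
    by (intro sum_mono2 T0) auto
  also have "\<dots> = (\<Sum>k\<in>{1..<6}. T k) + (\<Sum>k\<in>{6..<n\<^sup>2}. T k)"
    by (intro sum.union_disjoint) auto
  also have "(\<Sum>k\<in>{1..<6}. T k) \<le> (\<Sum>k\<in>{1..<6::nat}. 16 * exp 72 * ((real n)\<^sup>2 * c * exp (- (2 * c))))"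
    by (intro sum_mono small) auto
  also have "\<dots> = 80 * exp 72 * ((real n)\<^sup>2 * c * exp (- (2 * c)))" by simp
  also have "(\<Sum>k\<in>{6..<n\<^sup>2}. T k) \<le> (\<Sum>k\<in>{6..<n\<^sup>2}. (real n)\<^sup>2 * exp (- (c / 3)) * x ^ k)"
    by (intro sum_mono large)
  also have "\<dots> = (real n)\<^sup>2 * exp (- (c / 3)) * (\<Sum>k\<in>{6..<n\<^sup>2}. x ^ k)"
    by (simp add: sum_distrib_left)
  also have "\<dots> \<le> (real n)\<^sup>2 * exp (- (c / 3)) * (2 * x ^ 6)"
    by (intro mult_left_mono sum_geometric_tail_le x0) auto
  also have "\<dots> = 2 * (16 * c) ^ 6 * exp (- (c / 3)) * ((real n)\<^sup>2 * exp (- (2 * c)))"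
  proof -
    \<comment> \<open>This fixes the cutoff: six factors exp (- c / 3) make up exp (- 2 c), which
      outweighs n^2.\<close>
    have "exp (- (c / 3)) ^ 6 = exp (- (2 * c))" by (simp add: exp_of_nat_mult[symmetric])
    then have "x ^ 6 = (16 * c) ^ 6 * exp (- (2 * c))" by (simp only: x_def power_mult_distrib)
    then show ?thesis by (simp only: mult_ac)
  qed
  also have "\<dots> \<le> 2 * (16 * c) ^ 6 * exp (- (c / 3)) * 1"
    using n2 c0 by (intro mult_left_mono) auto
  finally show ?thesis by simp
qed

definition supercritical_error :: "(nat \<Rightarrow> real) \<Rightarrow> (nat \<Rightarrow> real) \<Rightarrow> nat \<Rightarrow> real" where
  "supercritical_error \<omega> c n = exp 2 * exp (- \<omega> n) +
     (80 * exp 72 * (exp (- (2 * \<omega> n)) * (2 + \<omega> n)) + 2 * (16 * c n) ^ 6 * exp (- (c n / 3)))"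

lemma supercritical_bound:
  fixes n :: nat and p :: real and \<omega> c :: "nat \<Rightarrow> real"
  defines "L \<equiv> ln (real n)"
  assumes p: "0 \<le> p" "p \<le> 1" and c_eq: "c n = L + 1/2 * ln L + \<omega> n" and p_eq: "p = c n / real n"
    and n: "n \<ge> 4" "L \<ge> 1" and \<omega>: "\<omega> n \<ge> 0" and c: "16 * c n * exp (- (c n / 3)) \<le> 1/2"
  shows "hypergraph_prob n p (\<lambda>E. \<not> homologically_connected (hypergraph_complex n E)) \<le> supercritical_error \<omega> c n"
proof -
  have n0: "real n > 0" using n by simp
  have np: "real n * p = c n" using n0 by (simp add: p_eq)
  have lnL: "0 \<le> ln L" "ln L \<le> L" using n(2) ln_le_minus_one[of L] by auto
  have "hypergraph_prob n p (\<lambda>E. \<not> homologically_connected (hypergraph_complex n E))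
    \<le> hypergraph_prob n p (\<lambda>E. (\<exists>v\<in>{1..n}. v \<noteq> 1 \<and> {1, v} \<notin> shadow E) \<or> (\<exists>G. nontrivial_cocycle E G))"
  proof (rule prob_random_hypergraph_mono, rule ccontr)
    fix E assume E: "E \<subseteq> triples n" "\<not> homologically_connected (hypergraph_complex n E)"
      and neg: "\<not> ((\<exists>v\<in>{1..n}. v \<noteq> 1 \<and> {1, v} \<notin> shadow E) \<or> (\<exists>G. nontrivial_cocycle E G))"
    have "homologically_connected (hypergraph_complex n E)"
    proof (rule homologically_connected_hypergraphI[OF E(1), of 1])
      show "\<exists>S. \<forall>e\<in>shadow E. e \<in> G \<longleftrightarrow> e \<in> vertex_cut S"
        if G: "G \<subseteq> shadow E" "\<And>t. t \<in> E \<Longrightarrow> even (card {e\<in>G. e \<subseteq> t})" for G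
      proof -
        have "\<not> nontrivial_cocycle E G" using neg by blast
        then have "\<exists>S. \<forall>e\<in>shadow E. \<not> (e \<in> G \<longleftrightarrow> e \<notin> vertex_cut S)"
          using G unfolding nontrivial_cocycle_def by auto
        then show ?thesis by blast
      qed
    qed (use neg n in auto)
    with E show False by simp
  qed
  also have "\<dots> \<le> hypergraph_prob n p (\<lambda>E. \<exists>v\<in>{1..n}. v \<noteq> 1 \<and> {1, v} \<notin> shadow E) +
      hypergraph_prob n p (\<lambda>E. \<exists>G. nontrivial_cocycle E G)"
    by (rule prob_pmf_union_le)
  also have "hypergraph_prob n p (\<lambda>E. \<exists>v\<in>{1..n}. v \<noteq> 1 \<and> {1, v} \<notin> shadow E) \<le> real n * (1 - p) ^ (n - 2)"
    using n by (intro prob_star_fails_le p) auto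
  also have "\<dots> \<le> real n * exp (2 - c n)"
  proof (rule mult_left_mono)
    have "(1 - p) ^ (n - 2) \<le> exp (- (real (n - 2) * p))"
      by (rule one_minus_power_le_exp[OF p(2)])
    also have "\<dots> \<le> exp (2 - c n)"
      using p n(1) np by (simp add: of_nat_diff algebra_simps)
    finally show "(1 - p) ^ (n - 2) \<le> exp (2 - c n)" .
  qed simp
  also have "\<dots> \<le> exp 2 * exp (- \<omega> n)"
  proof -
    have "real n * exp (2 - c n) = exp (L + (2 - c n))" using n0 by (simp add: L_def exp_add)
    also have "\<dots> \<le> exp (2 + - \<omega> n)" using lnL by (simp add: c_eq)
    finally show ?thesis by (simp only: exp_add)
  qed
  also have "hypergraph_prob n p (\<lambda>E. \<exists>G. nontrivial_cocycle E G) \<le>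
      80 * exp 72 * ((real n)\<^sup>2 * c n * exp (- (2 * c n))) + 2 * (16 * c n) ^ 6 * exp (- (c n / 3))"
    using prob_nontrivial_cocycle_le[OF p, of n] n c lnL \<omega> unfolding np L_def[symmetric] by (auto simp: c_eq)
  \<comment> \<open>The summand log log n / 2 produces a divisor L, and c / L \<le> 2 + \<omega>;
    this factor is harmless against exp (- 2 \<omega>) however fast \<omega> grows.\<close>
  also have "(real n)\<^sup>2 * c n * exp (- (2 * c n)) \<le> exp (- (2 * \<omega> n)) * (2 + \<omega> n)"
  proof -
    have eq: "- (2 * c n) = - (2 * \<omega> n) - (L + L + ln L)" by (simp add: c_eq algebra_simps)
    have "exp (- (2 * c n)) = exp (- (2 * \<omega> n)) / (exp L * exp L * exp (ln L))"
      by (simp only: eq exp_diff exp_add)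
    then have e: "(real n)\<^sup>2 * exp (- (2 * c n)) = exp (- (2 * \<omega> n)) / L"
      using n n0 by (simp add: L_def power2_eq_square)
    have "\<omega> n * 1 \<le> \<omega> n * L" using \<omega> n by (intro mult_left_mono) auto
    then have "c n \<le> (2 + \<omega> n) * L" using lnL n by (simp add: c_eq algebra_simps)
    then have "c n / L \<le> 2 + \<omega> n" using n by (simp add: field_simps)
    then have "exp (- (2 * \<omega> n)) * (c n / L) \<le> exp (- (2 * \<omega> n)) * (2 + \<omega> n)"
      by (intro mult_left_mono) auto
    moreover have "(real n)\<^sup>2 * c n * exp (- (2 * c n)) = exp (- (2 * \<omega> n)) * (c n / L)"
      using arg_cong[OF e, of "\<lambda>y. y * c n"] by (simp add: mult_ac)
    ultimately show ?thesis by simp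
  qed
  finally show ?thesis by (simp add: supercritical_error_def)
qed

lemma supercritical_connected:
  fixes \<omega> p :: "nat \<Rightarrow> real"
  assumes \<omega>: "filterlim \<omega> at_top sequentially" and p: "\<And>n. 0 \<le> p n" "\<And>n. p n \<le> 1"
    and p_eq: "\<forall>\<^sub>F n in sequentially. p n = (ln (real n) + 1 / 2 * ln (ln (real n)) + \<omega> n) / real n"
  shows "(\<lambda>n. hypergraph_prob n (p n) (\<lambda>E. \<not> homologically_connected (hypergraph_complex n E))) \<longlonglongrightarrow> 0"
proof -
  define c where "c = (\<lambda>n. ln (real n) + 1 / 2 * ln (ln (real n)) + \<omega> n)"
  have "filterlim (\<lambda>n. ln (real n) + 1 / 2 * ln (ln (real n))) at_top sequentially"
    by real_asymp
  then have c_top: "filterlim c at_top sequentially"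
    unfolding c_def using \<omega> by (rule filterlim_at_top_add_at_top)
  have "((\<lambda>x::real. 2 * (16 * x) ^ 6 * exp (- (x / 3))) \<longlongrightarrow> 0) at_top" by real_asymp
  then have 1: "(\<lambda>n. 2 * (16 * c n) ^ 6 * exp (- (c n / 3))) \<longlonglongrightarrow> 0"
    using c_top by (rule filterlim_compose)
  have "((\<lambda>x::real. exp 2 * exp (- x)) \<longlongrightarrow> 0) at_top" by real_asymp
  then have 2: "(\<lambda>n. exp 2 * exp (- \<omega> n)) \<longlonglongrightarrow> 0"
    using \<omega> by (rule filterlim_compose)
  have "((\<lambda>x::real. 80 * exp 72 * (exp (- (2 * x)) * (2 + x))) \<longlongrightarrow> 0) at_top" by real_asymp
  then have 3: "(\<lambda>n. 80 * exp 72 * (exp (- (2 * \<omega> n)) * (2 + \<omega> n))) \<longlonglongrightarrow> 0"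
    using \<omega> by (rule filterlim_compose)
  have err: "supercritical_error \<omega> c \<longlonglongrightarrow> 0"
    unfolding supercritical_error_def using tendsto_add[OF 2 tendsto_add[OF 3 1]] by simp
  show ?thesis
  proof (rule tendsto_sandwich[OF _ _ tendsto_const err])
    have "\<forall>\<^sub>F x::real in at_top. 16 * x * exp (- (x / 3)) \<le> 1/2" by real_asymp
    then have "\<forall>\<^sub>F n in sequentially. 16 * c n * exp (- (c n / 3)) \<le> 1/2"
      using c_top by (rule eventually_compose_filterlim)
    moreover have "\<forall>\<^sub>F n in sequentially. \<omega> n \<ge> 0"
      using \<omega> by (simp add: filterlim_at_top)
    moreover have "\<forall>\<^sub>F n in sequentially. n \<ge> 4 \<and> ln (real n) \<ge> 1"
      by (intro eventually_conj eventually_ge_at_top; real_asymp)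
    ultimately show "\<forall>\<^sub>F n in sequentially.
        hypergraph_prob n (p n) (\<lambda>E. \<not> homologically_connected (hypergraph_complex n E)) \<le> supercritical_error \<omega> c n"
      using p_eq
    proof eventually_elim
      case (elim n)
      then show ?case
        using p[of n] by (intro supercritical_bound) (auto simp: c_def)
    qed
  qed simp
qed

text \<open>The formula for \<open>p\<close> is imposed only for large n, since for small n the
  iterated logarithm may be meaningless or the value may lie outside the unit interval.\<close>

theorem theorem1p1:
  fixes \<omega> :: "nat \<Rightarrow> real"
  assumes "filterlim \<omega> at_top sequentially"
  shows "(\<forall>p :: nat \<Rightarrow> real.
           (\<forall>n. 0 \<le> p n \<and> p n \<le> 1) \<longrightarrow>
           (\<forall>\<^sub>F n in sequentially. p n = (ln (real n) + 1 / 2 * ln (ln (real n)) - \<omega> n) / real n) \<longrightarrow>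
           (\<lambda>n. measure_pmf.prob (random_hypergraph n (p n))
                  {E. \<not> homologically_connected (hypergraph_complex n E)}) \<longlonglongrightarrow> 1) \<and>
         (\<forall>p :: nat \<Rightarrow> real.
           (\<forall>n. 0 \<le> p n \<and> p n \<le> 1) \<longrightarrow>
           (\<forall>\<^sub>F n in sequentially. p n = (ln (real n) + 1 / 2 * ln (ln (real n)) + \<omega> n) / real n) \<longrightarrow>
           (\<lambda>n. measure_pmf.prob (random_hypergraph n (p n))
                  {E. homologically_connected (hypergraph_complex n E)}) \<longlonglongrightarrow> 1)"
proof (intro conjI allI impI)
  fix p :: "nat \<Rightarrow> real"
  assume p: "\<forall>n. 0 \<le> p n \<and> p n \<le> 1"
    "\<forall>\<^sub>F n in sequentially. p n = (ln (real n) + 1 / 2 * ln (ln (real n)) - \<omega> n) / real n"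
  have "(\<lambda>n. 1 - hypergraph_prob n (p n) (\<lambda>E. homologically_connected (hypergraph_complex n E))) \<longlonglongrightarrow> 1 - 0"
    by (intro tendsto_diff tendsto_const subcritical_not_connected[OF assms]) (use p in auto)
  then show "(\<lambda>n. measure_pmf.prob (random_hypergraph n (p n))
      {E. \<not> homologically_connected (hypergraph_complex n E)}) \<longlonglongrightarrow> 1"
    by (simp add: prob_pmf_not)
next
  fix p :: "nat \<Rightarrow> real"
  assume p: "\<forall>n. 0 \<le> p n \<and> p n \<le> 1"
    "\<forall>\<^sub>F n in sequentially. p n = (ln (real n) + 1 / 2 * ln (ln (real n)) + \<omega> n) / real n"
  have "(\<lambda>n. 1 - hypergraph_prob n (p n) (\<lambda>E. \<not> homologically_connected (hypergraph_complex n E))) \<longlonglongrightarrow> 1 - 0"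
    by (intro tendsto_diff tendsto_const supercritical_connected[OF assms]) (use p in auto)
  then show "(\<lambda>n. measure_pmf.prob (random_hypergraph n (p n))
      {E. homologically_connected (hypergraph_complex n E)}) \<longlonglongrightarrow> 1"
    by (simp add: prob_pmf_not)
qed

end
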